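(* Let $H$ and $N$ be finite groups, let $H_1\le Z(H)$ and $N_1\le Z(N)$, let $\xi:H_1\to N_1$ be an isomorphism, and let $G$ be the central product of $H$ and $N$ via the map $\xi$. Suppose that $\mathrm{B}_0(H)=\mathrm{B}_0(N)=0$, and that at least one of the following conditions is satisfied: (i) $\xi(H_1\cap H')\subseteq N_1\cap K(N)$; (ii) there is a homomorphism $\eta:H\to N$ such that $\xi=\eta|_{H_1}$. Then $\mathrm{B}_0(G)=0$ if and only if $\mathrm{B}_0(H/H_1)=0$.
   Context: For a group $X$, $[x,y]=x^{-1}y^{-1}xy$, $X'$ is the commutator subgroup, $Z(X)$ is the center, and $K(X)=\{[x,y]\mid x,y\in X\}$ is the set of commutators. For a finite group $X$, with $\mathbb{Q}/\mathbb{Z}$ a trivial $X$-module, the Bogomolov multiplier is $$\mathrm{B}_0(X)=\bigcap_{A\le X,\ A\text{ abelian}}\ker\big(\mathrm{res}^X_A: \mathrm{H}^2(X,\mathbb{Q}/\mathbb{Z})\to \mathrm{H}^2(A,\mathbb{Q}/\mathbb{Z})\big).$$ Given $H_1\le Z(H)$, $N_1\le Z(N)$ and an isomorphism $\xi:H_1\to N_1$, the central product of $H$ and $N$ via $\xi$ is $G=(H\times N)/Z$ with $Z=\{(a,\xi(a)^{-1})\mid a\in H_1\}$. *)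

theory Defs
  imports "HOL-Algebra.Algebra"
begin

definition center :: "('a, 'm) monoid_scheme \<Rightarrow> 'a set" where
  "center G = {z \<in> carrier G. \<forall>x\<in>carrier G. z \<otimes>\<^bsub>G\<^esub> x = x \<otimes>\<^bsub>G\<^esub> z}"

text \<open>
  The commutator convention is \<open>[x, y] = x\<^sup>-\<^sup>1 y\<^sup>-\<^sup>1 x y\<close>. The library's \<^const>\<open>derived\<close> uses
  \<open>x y x\<^sup>-\<^sup>1 y\<^sup>-\<^sup>1\<close>; both conventions give the same set of commutators (replace \<open>x\<close>, \<open>y\<close> by their
  inverses), hence the same commutator subgroup \<open>derived G (carrier G)\<close>.
\<close>

definition commutators :: "('a, 'm) monoid_scheme \<Rightarrow> 'a set" where
  "commutators G = {inv\<^bsub>G\<^esub> x \<otimes>\<^bsub>G\<^esub> inv\<^bsub>G\<^esub> y \<otimes>\<^bsub>G\<^esub> x \<otimes>\<^bsub>G\<^esub> y | x y. x \<in> carrier G \<and> y \<in> carrier G}"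

lemma (in group) commutators_eq_derived_set: "commutators G = derived_set G (carrier G)"
proof (intro equalityI subsetI)
  fix c assume "c \<in> commutators G"
  then obtain x y where "x \<in> carrier G" "y \<in> carrier G" "c = inv x \<otimes> inv y \<otimes> x \<otimes> y"
    by (auto simp: commutators_def)
  then show "c \<in> derived_set G (carrier G)"
    by (intro UN_I[of "inv x"] UN_I[of "inv y"]) auto
next
  fix c assume "c \<in> derived_set G (carrier G)"
  then obtain x y where "x \<in> carrier G" "y \<in> carrier G" "c = x \<otimes> y \<otimes> inv x \<otimes> inv y"
    by auto
  then show "c \<in> commutators G"
    unfolding commutators_def by (intro CollectI exI[of _ "inv x"] exI[of _ "inv y"]) auto
qed

definition central_product ::
  "('a, 'm) monoid_scheme \<Rightarrow> ('b, 'n) monoid_scheme \<Rightarrow> 'a set \<Rightarrow> ('a \<Rightarrow> 'b) \<Rightarrow> ('a \<times> 'b) set monoid"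
  where "central_product H N H\<^sub>1 \<xi> = (H \<times>\<times> N) Mod {(a, inv\<^bsub>N\<^esub> (\<xi> a)) | a. a \<in> H\<^sub>1}"

text \<open>
  Second cohomology with coefficients in an abelian group \<open>M\<close>, regarded as a trivial \<open>G\<close>-module,
  by inhomogeneous cochains. Both groups are written multiplicatively, as usual in the library.
\<close>

definition cochains1 :: "('a, 'm) monoid_scheme \<Rightarrow> ('c, 'k) monoid_scheme \<Rightarrow> ('a \<Rightarrow> 'c) monoid" where
  "cochains1 G M = product_group (carrier G) (\<lambda>_. M)"

definition cochains2 ::
  "('a, 'm) monoid_scheme \<Rightarrow> ('c, 'k) monoid_scheme \<Rightarrow> ('a \<times> 'a \<Rightarrow> 'c) monoid" where
  "cochains2 G M = product_group (carrier G \<times> carrier G) (\<lambda>_. M)"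

text \<open>Additively, the cocycle condition is \<open>f(y,z) - f(xy,z) + f(x,yz) - f(x,y) = 0\<close>.\<close>

definition cocycles2 ::
  "('a, 'm) monoid_scheme \<Rightarrow> ('c, 'k) monoid_scheme \<Rightarrow> ('a \<times> 'a \<Rightarrow> 'c) monoid" where
  "cocycles2 G M = (cochains2 G M)\<lparr>carrier := {f \<in> carrier (cochains2 G M).
     \<forall>x\<in>carrier G. \<forall>y\<in>carrier G. \<forall>z\<in>carrier G.
       f (y, z) \<otimes>\<^bsub>M\<^esub> f (x, y \<otimes>\<^bsub>G\<^esub> z) = f (x \<otimes>\<^bsub>G\<^esub> y, z) \<otimes>\<^bsub>M\<^esub> f (x, y)}\<rparr>"

definition coboundary ::
  "('a, 'm) monoid_scheme \<Rightarrow> ('c, 'k) monoid_scheme \<Rightarrow> ('a \<Rightarrow> 'c) \<Rightarrow> 'a \<times> 'a \<Rightarrow> 'c" where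
  "coboundary G M g = (\<lambda>(x, y)\<in>carrier G \<times> carrier G.
     g y \<otimes>\<^bsub>M\<^esub> inv\<^bsub>M\<^esub> (g (x \<otimes>\<^bsub>G\<^esub> y)) \<otimes>\<^bsub>M\<^esub> g x)"

definition coboundaries2 ::
  "('a, 'm) monoid_scheme \<Rightarrow> ('c, 'k) monoid_scheme \<Rightarrow> ('a \<times> 'a \<Rightarrow> 'c) set" where
  "coboundaries2 G M = coboundary G M ` carrier (cochains1 G M)"

definition H2 ::
  "('a, 'm) monoid_scheme \<Rightarrow> ('c, 'k) monoid_scheme \<Rightarrow> ('a \<times> 'a \<Rightarrow> 'c) set monoid" where
  "H2 G M = cocycles2 G M Mod coboundaries2 G M"

text \<open>
  A class \<open>c\<close> is a coset of cocycles; all its members restrict to the same class of the subgroup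
  \<open>A\<close>, see \<open>H2_res_coset\<close> below.
\<close>

definition H2_res ::
  "('a, 'm) monoid_scheme \<Rightarrow> ('c, 'k) monoid_scheme \<Rightarrow> 'a set
    \<Rightarrow> ('a \<times> 'a \<Rightarrow> 'c) set \<Rightarrow> ('a \<times> 'a \<Rightarrow> 'c) set" where
  "H2_res G M A c = the_elem
     ((\<lambda>f. coboundaries2 (G\<lparr>carrier := A\<rparr>) M
        #>\<^bsub>cocycles2 (G\<lparr>carrier := A\<rparr>) M\<^esub> restrict f (A \<times> A)) ` c)"

lemma cocycles2_mult [simp]:
  "(\<otimes>\<^bsub>cocycles2 G M\<^esub>) = (\<lambda>f g. \<lambda>i\<in>carrier G \<times> carrier G. f i \<otimes>\<^bsub>M\<^esub> g i)"
  by (simp add: cocycles2_def cochains2_def)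

lemma cocycles2_one [simp]: "\<one>\<^bsub>cocycles2 G M\<^esub> = (\<lambda>i\<in>carrier G \<times> carrier G. \<one>\<^bsub>M\<^esub>)"
  by (simp add: cocycles2_def cochains2_def)

lemma mem_cocycles2:
  "f \<in> carrier (cocycles2 G M) \<longleftrightarrow> f \<in> carrier G \<times> carrier G \<rightarrow>\<^sub>E carrier M \<and>
     (\<forall>x\<in>carrier G. \<forall>y\<in>carrier G. \<forall>z\<in>carrier G.
       f (y, z) \<otimes>\<^bsub>M\<^esub> f (x, y \<otimes>\<^bsub>G\<^esub> z) = f (x \<otimes>\<^bsub>G\<^esub> y, z) \<otimes>\<^bsub>M\<^esub> f (x, y))"
  by (simp add: cocycles2_def cochains2_def)

context
  fixes G :: "('a, 'm) monoid_scheme" and M :: "('c, 'k) monoid_scheme"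
  assumes G: "group G" and M: "comm_group M"
begin

interpretation G: group G by (rule G)
interpretation M: comm_group M by (rule M)

lemma subgroup_cocycles2: "subgroup (carrier (cocycles2 G M)) (cochains2 G M)"
proof -
  interpret C: group "cochains2 G M" by (simp add: cochains2_def)
  show ?thesis
  proof (rule C.subgroupI)
    show "carrier (cocycles2 G M) \<subseteq> carrier (cochains2 G M)"
      by (auto simp: cocycles2_def)
    have "(\<lambda>i\<in>carrier G \<times> carrier G. \<one>\<^bsub>M\<^esub>) \<in> carrier (cocycles2 G M)"
      by (simp add: mem_cocycles2)
    then show "carrier (cocycles2 G M) \<noteq> {}" by blast
  next
    fix f assume f: "f \<in> carrier (cocycles2 G M)"
    then have fm: "f (x, y) \<in> carrier M" if "x \<in> carrier G" "y \<in> carrier G" for x y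
      using that by (auto simp: mem_cocycles2)
    have "inv\<^bsub>cochains2 G M\<^esub> f = (\<lambda>i\<in>carrier G \<times> carrier G. inv\<^bsub>M\<^esub> f i)"
      using f by (simp add: cochains2_def mem_cocycles2)
    then show "inv\<^bsub>cochains2 G M\<^esub> f \<in> carrier (cocycles2 G M)"
      using f by (auto simp: mem_cocycles2 fm simp flip: M.inv_mult)
  next
    fix f g assume f: "f \<in> carrier (cocycles2 G M)" and g: "g \<in> carrier (cocycles2 G M)"
    have fm: "f (x, y) \<in> carrier M" "g (x, y) \<in> carrier M"
      if "x \<in> carrier G" "y \<in> carrier G" for x y
      using f g that by (auto simp: mem_cocycles2)
    have swap: "(a \<otimes>\<^bsub>M\<^esub> b) \<otimes>\<^bsub>M\<^esub> (c \<otimes>\<^bsub>M\<^esub> d) = (a \<otimes>\<^bsub>M\<^esub> c) \<otimes>\<^bsub>M\<^esub> (b \<otimes>\<^bsub>M\<^esub> d)"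
      if "a \<in> carrier M" "b \<in> carrier M" "c \<in> carrier M" "d \<in> carrier M" for a b c d
      using that by (simp add: M.m_ac)
    have "(f (y, z) \<otimes>\<^bsub>M\<^esub> g (y, z)) \<otimes>\<^bsub>M\<^esub> (f (x, y \<otimes>\<^bsub>G\<^esub> z) \<otimes>\<^bsub>M\<^esub> g (x, y \<otimes>\<^bsub>G\<^esub> z)) =
        (f (x \<otimes>\<^bsub>G\<^esub> y, z) \<otimes>\<^bsub>M\<^esub> g (x \<otimes>\<^bsub>G\<^esub> y, z)) \<otimes>\<^bsub>M\<^esub> (f (x, y) \<otimes>\<^bsub>M\<^esub> g (x, y))"
      if "x \<in> carrier G" "y \<in> carrier G" "z \<in> carrier G" for x y z
      using f g that by (subst (1 2) swap) (simp_all add: fm mem_cocycles2)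
    then have "(\<lambda>i\<in>carrier G \<times> carrier G. f i \<otimes>\<^bsub>M\<^esub> g i) \<in> carrier (cocycles2 G M)"
      by (auto simp: mem_cocycles2 fm)
    then show "f \<otimes>\<^bsub>cochains2 G M\<^esub> g \<in> carrier (cocycles2 G M)"
      by (simp add: cochains2_def)
  qed
qed

lemma comm_group_cocycles2: "comm_group (cocycles2 G M)"
proof -
  interpret C: group "cochains2 G M" by (simp add: cochains2_def)
  have "group (cocycles2 G M)"
    using C.subgroup_imp_group[OF subgroup_cocycles2] by (simp add: cocycles2_def)
  then show ?thesis
    by (rule group.group_comm_groupI) (auto simp: mem_cocycles2 fun_eq_iff intro!: M.m_comm)
qed

lemma coboundary_in_cocycles2:
  assumes "g \<in> carrier (cochains1 G M)"
  shows "coboundary G M g \<in> carrier (cocycles2 G M)"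
proof -
  have g: "g x \<in> carrier M" if "x \<in> carrier G" for x
    using assms that by (auto simp: cochains1_def)
  have cancel: "a \<otimes>\<^bsub>M\<^esub> (inv\<^bsub>M\<^esub> a \<otimes>\<^bsub>M\<^esub> b) = b" if "a \<in> carrier M" "b \<in> carrier M" for a b
    using that by (simp flip: M.m_assoc)
  have "(c \<otimes>\<^bsub>M\<^esub> inv\<^bsub>M\<^esub> p \<otimes>\<^bsub>M\<^esub> b) \<otimes>\<^bsub>M\<^esub> (p \<otimes>\<^bsub>M\<^esub> inv\<^bsub>M\<^esub> r \<otimes>\<^bsub>M\<^esub> a) =
      (c \<otimes>\<^bsub>M\<^esub> inv\<^bsub>M\<^esub> r \<otimes>\<^bsub>M\<^esub> q) \<otimes>\<^bsub>M\<^esub> (b \<otimes>\<^bsub>M\<^esub> inv\<^bsub>M\<^esub> q \<otimes>\<^bsub>M\<^esub> a)"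
    if "a \<in> carrier M" "b \<in> carrier M" "c \<in> carrier M" "p \<in> carrier M" "q \<in> carrier M"
      "r \<in> carrier M" for a b c p q r
  proof -
    have "(c \<otimes>\<^bsub>M\<^esub> inv\<^bsub>M\<^esub> p \<otimes>\<^bsub>M\<^esub> b) \<otimes>\<^bsub>M\<^esub> (p \<otimes>\<^bsub>M\<^esub> inv\<^bsub>M\<^esub> r \<otimes>\<^bsub>M\<^esub> a) =
        p \<otimes>\<^bsub>M\<^esub> (inv\<^bsub>M\<^esub> p \<otimes>\<^bsub>M\<^esub> (a \<otimes>\<^bsub>M\<^esub> (b \<otimes>\<^bsub>M\<^esub> (c \<otimes>\<^bsub>M\<^esub> inv\<^bsub>M\<^esub> r))))"
      using that by (simp add: M.m_ac)
    also have "\<dots> = q \<otimes>\<^bsub>M\<^esub> (inv\<^bsub>M\<^esub> q \<otimes>\<^bsub>M\<^esub> (a \<otimes>\<^bsub>M\<^esub> (b \<otimes>\<^bsub>M\<^esub> (c \<otimes>\<^bsub>M\<^esub> inv\<^bsub>M\<^esub> r))))"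
      using that by (simp add: cancel)
    also have "\<dots> = (c \<otimes>\<^bsub>M\<^esub> inv\<^bsub>M\<^esub> r \<otimes>\<^bsub>M\<^esub> q) \<otimes>\<^bsub>M\<^esub> (b \<otimes>\<^bsub>M\<^esub> inv\<^bsub>M\<^esub> q \<otimes>\<^bsub>M\<^esub> a)"
      using that by (simp add: M.m_ac)
    finally show ?thesis .
  qed
  then show ?thesis
    by (auto simp: mem_cocycles2 coboundary_def g G.m_assoc)
qed

lemma coboundary_hom: "coboundary G M \<in> hom (cochains1 G M) (cocycles2 G M)"
proof (rule homI)
  fix f g assume "f \<in> carrier (cochains1 G M)" "g \<in> carrier (cochains1 G M)"
  then have fg: "f x \<in> carrier M" "g x \<in> carrier M" if "x \<in> carrier G" for x
    using that by (auto simp: cochains1_def)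
  show "coboundary G M (f \<otimes>\<^bsub>cochains1 G M\<^esub> g) =
      coboundary G M f \<otimes>\<^bsub>cocycles2 G M\<^esub> coboundary G M g"
    by (auto simp: fun_eq_iff coboundary_def cochains1_def fg M.inv_mult M.m_ac)
qed (rule coboundary_in_cocycles2)

lemma coboundaries2_normal: "coboundaries2 G M \<lhd> cocycles2 G M"
proof -
  interpret Z: comm_group "cocycles2 G M" by (rule comm_group_cocycles2)
  interpret h: group_hom "cochains1 G M" "cocycles2 G M" "coboundary G M"
    by (intro group_hom.intro group_hom_axioms.intro coboundary_hom Z.is_group)
      (simp add: cochains1_def)
  show ?thesis
    using h.img_is_subgroup Z.subgroup_imp_normal by (simp add: coboundaries2_def)
qed

lemma comm_group_H2: "comm_group (H2 G M)"
  unfolding H2_def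
  using comm_group.abelian_FactGroup[OF comm_group_cocycles2] coboundaries2_normal normal_imp_subgroup
  by blast

end

lemma H2_res_coset:
  assumes G: "group G" and M: "comm_group M" and A: "subgroup A G"
    and f: "f \<in> carrier (cocycles2 G M)"
  shows "H2_res G M A (coboundaries2 G M #>\<^bsub>cocycles2 G M\<^esub> f) =
    coboundaries2 (G\<lparr>carrier := A\<rparr>) M #>\<^bsub>cocycles2 (G\<lparr>carrier := A\<rparr>) M\<^esub> restrict f (A \<times> A)"
proof -
  let ?A = "G\<lparr>carrier := A\<rparr>"
  let ?B = "coboundaries2 ?A M" and ?Z = "cocycles2 ?A M"
  have A': "group ?A" using A G by (rule subgroup.subgroup_is_group)
  interpret G: group G by (rule G)
  interpret M: comm_group M by (rule M)
  interpret ZG: comm_group "cocycles2 G M" using G M by (rule comm_group_cocycles2)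
  interpret Z: comm_group ?Z using A' M by (rule comm_group_cocycles2)
  have AG: "A \<subseteq> carrier G" and Am: "\<And>x y. x \<in> A \<Longrightarrow> y \<in> A \<Longrightarrow> x \<otimes>\<^bsub>G\<^esub> y \<in> A"
    using A subgroup.subset subgroup.m_closed by fast+
  have B: "subgroup ?B ?Z"
    using coboundaries2_normal[OF A' M] by (rule normal_imp_subgroup)
  have BG: "subgroup (coboundaries2 G M) (cocycles2 G M)"
    using coboundaries2_normal[OF G M] by (rule normal_imp_subgroup)
  have fr: "restrict f (A \<times> A) \<in> carrier ?Z"
    using f AG by (auto simp: mem_cocycles2 Am PiE_iff subset_iff)
  have same: "?B #>\<^bsub>?Z\<^esub> restrict h (A \<times> A) = ?B #>\<^bsub>?Z\<^esub> restrict f (A \<times> A)"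
    if h: "h \<in> coboundaries2 G M #>\<^bsub>cocycles2 G M\<^esub> f" for h
  proof -
    from h obtain g where g: "g \<in> carrier (cochains1 G M)"
      and h_eq: "h = coboundary G M g \<otimes>\<^bsub>cocycles2 G M\<^esub> f"
      by (auto simp: r_coset_def coboundaries2_def)
    let ?b = "coboundary ?A M (restrict g A)"
    have b: "?b \<in> ?B"
      unfolding coboundaries2_def
      by (rule imageI) (use g AG in \<open>auto simp: cochains1_def PiE_iff extensional_def\<close>)
    have "restrict h (A \<times> A) = ?b \<otimes>\<^bsub>?Z\<^esub> restrict f (A \<times> A)"
      using AG by (auto simp: h_eq fun_eq_iff coboundary_def Am)
    then have "restrict h (A \<times> A) \<in> ?B #>\<^bsub>?Z\<^esub> restrict f (A \<times> A)"
      using b by (auto simp: r_coset_def)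
    then show ?thesis
      using Z.repr_independence[OF _ fr B] by simp
  qed
  have self: "f \<in> coboundaries2 G M #>\<^bsub>cocycles2 G M\<^esub> f"
    using ZG.rcos_self[OF f BG] .
  have "(\<lambda>h. ?B #>\<^bsub>?Z\<^esub> restrict h (A \<times> A)) ` (coboundaries2 G M #>\<^bsub>cocycles2 G M\<^esub> f)
      = (\<lambda>h. ?B #>\<^bsub>?Z\<^esub> restrict f (A \<times> A)) ` (coboundaries2 G M #>\<^bsub>cocycles2 G M\<^esub> f)"
    by (rule image_cong[OF refl same])
  also have "\<dots> = {?B #>\<^bsub>?Z\<^esub> restrict f (A \<times> A)}"
    by (rule image_constant[OF self])
  finally show ?thesis
    by (simp only: H2_res_def the_elem_eq)
qed

definition rat_mod_int :: "rat set monoid" where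
  "rat_mod_int = \<lparr>carrier = UNIV, monoid.mult = (+), one = 0\<rparr> Mod \<int>"

lemma comm_group_rat_mod_int: "comm_group rat_mod_int"
proof -
  let ?Q = "\<lparr>carrier = UNIV, monoid.mult = (+), one = 0\<rparr> :: rat monoid"
  interpret comm_group ?Q
    proof (rule comm_groupI)
    show "\<exists>y\<in>carrier ?Q. y \<otimes>\<^bsub>?Q\<^esub> x = \<one>\<^bsub>?Q\<^esub>" for x
      by (simp add: exI[of _ "- x"])
  qed simp_all
  have "inv\<^bsub>?Q\<^esub> x = - x" for x
    by (rule inv_equality) auto
  then have "subgroup \<int> ?Q"
    by unfold_locales auto
  then show ?thesis
    unfolding rat_mod_int_def by (rule abelian_FactGroup)
qed

definition bogomolov_multiplier :: "('a, 'm) monoid_scheme \<Rightarrow> ('a \<times> 'a \<Rightarrow> rat set) set set" where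
  "bogomolov_multiplier G =
    (\<Inter>A\<in>{A. subgroup A G \<and> comm_group (G\<lparr>carrier := A\<rparr>)}.
       kernel (H2 G rat_mod_int) (H2 (G\<lparr>carrier := A\<rparr>) rat_mod_int) (H2_res G rat_mod_int A))"

definition trivial_bogomolov_multiplier :: "('a, 'm) monoid_scheme \<Rightarrow> bool" where
  "trivial_bogomolov_multiplier G \<longleftrightarrow> bogomolov_multiplier G = {\<one>\<^bsub>H2 G rat_mod_int\<^esub>}"

end

theory Submission
  imports Defs
begin

text \<open>
  Write \<open>D\<close> for the rationals modulo the integers, a divisible group. A \<open>D\<close>-valued cocycle \<open>f\<close> on a
  finite abelian group is a coboundary iff it is symmetric, so the Bogomolov multiplier of \<open>X\<close>
  consists of the classes of those \<open>f\<close> with \<open>f x y = f y x\<close> for all commuting \<open>x\<close>, \<open>y\<close>. It follows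
  that direct products preserve triviality, because the two factors commute elementwise.

  Let \<open>C\<close> be central in \<open>X\<close>, where \<open>X\<close> has trivial multiplier. Classes on \<open>X/C\<close> that are symmetric on
  commuting pairs become trivial on \<open>X\<close>, hence are transgressions of characters \<open>\<chi>\<close> of \<open>C\<close>; such a
  transgression is symmetric on commuting pairs iff \<open>\<chi>\<close> kills \<open>C \<inter> K(X)\<close>, and is trivial iff \<open>\<chi>\<close>
  extends to \<open>X\<close>, i.e. kills \<open>C \<inter> X'\<close>. So \<open>X/C\<close> has trivial multiplier iff every character of \<open>C\<close>
  killing \<open>C \<inter> K(X)\<close> kills \<open>C \<inter> X'\<close>. Apply this to \<open>(H, H\<^sub>1)\<close> and \<open>(H \<times> N, Z)\<close>: either condition
  on \<open>\<xi>\<close> makes the first projection \<open>Z \<rightarrow> H\<^sub>1\<close> match \<open>Z \<inter> K(H \<times> N)\<close> with \<open>H\<^sub>1 \<inter> K(H)\<close> and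
  \<open>Z \<inter> (H \<times> N)'\<close> with \<open>H\<^sub>1 \<inter> H'\<close>.
\<close>

section \<open>Extending homomorphisms into divisible groups\<close>

locale divisible_group = comm_group M for M (structure) +
  assumes divisible: "\<lbrakk>d \<in> carrier M; 0 < n\<rbrakk> \<Longrightarrow> \<exists>e\<in>carrier M. e [^] (n::nat) = d"
begin

text \<open>A candidate value \<open>d\<close> at \<open>a\<close>, compatible with \<chi> on every
  power of \<open>a\<close> lying in \<open>C\<close>. If only the exponent 0 gives such a power,
  \<one> will do. Otherwise the exponents giving such powers are the multiples of the least positive
  one, \<open>n\<close>, and divisibility supplies an \<open>n\<close>-th root of
  \<chi>(a^n).\<close>

lemma hom_on_powers:
  assumes "group E" and C: "subgroup C E" and \<chi>: "\<chi> \<in> hom (E\<lparr>carrier := C\<rparr>) M"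
    and a: "a \<in> carrier E"
  obtains d where "d \<in> carrier M"
    and "\<And>i::int. a [^]\<^bsub>E\<^esub> i \<in> C \<Longrightarrow> \<chi> (a [^]\<^bsub>E\<^esub> i) = d [^] i"
proof -
  interpret E: group E by fact
  interpret \<chi>: group_hom "E\<lparr>carrier := C\<rparr>" M \<chi>
    using \<chi> E.subgroup_imp_group[OF C] by (simp add: group_hom_def group_hom_axioms_def)
  show thesis
  proof (cases "\<exists>i::int. i \<noteq> 0 \<and> a [^]\<^bsub>E\<^esub> i \<in> C")
    case False
    then have "i = 0" if "a [^]\<^bsub>E\<^esub> i \<in> C" for i :: int
      using that by blast
    then show ?thesis
      using that[of \<one>] \<chi>.hom_one by force
  next
    case True
    then obtain i :: int where i: "i \<noteq> 0" "a [^]\<^bsub>E\<^esub> i \<in> C" by blast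
    have "a [^]\<^bsub>E\<^esub> (- i) \<in> C"
      using subgroup.m_inv_closed[OF C i(2)] by (simp add: E.int_pow_neg a)
    then have "a [^]\<^bsub>E\<^esub> int (nat \<bar>i\<bar>) \<in> C"
      using i(2) by (cases "i \<ge> 0") auto
    then have ex: "\<exists>n::nat. 0 < n \<and> a [^]\<^bsub>E\<^esub> int n \<in> C"
      using i(1) by (intro exI[of _ "nat \<bar>i\<bar>"]) auto
    define n where "n = (LEAST n::nat. 0 < n \<and> a [^]\<^bsub>E\<^esub> int n \<in> C)"
    have n: "0 < n" "a [^]\<^bsub>E\<^esub> int n \<in> C"
      using LeastI_ex[OF ex] by (auto simp: n_def)
    have least: "n \<le> m" if "0 < m" "a [^]\<^bsub>E\<^esub> int m \<in> C" for m :: nat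
      using Least_le[of "\<lambda>n. 0 < n \<and> a [^]\<^bsub>E\<^esub> int n \<in> C" m] that by (auto simp: n_def)
    have "\<chi> (a [^]\<^bsub>E\<^esub> int n) \<in> carrier M"
      using \<chi>.hom_closed n(2) by simp
    then obtain d where d: "d \<in> carrier M" "d [^] n = \<chi> (a [^]\<^bsub>E\<^esub> int n)"
      using divisible n(1) by blast
    have pw: "(a [^]\<^bsub>E\<^esub> int n) [^]\<^bsub>E\<^esub> q \<in> C" for q :: int
      using E.subgroup_int_pow_closed[OF C n(2)] .
    have "\<chi> (a [^]\<^bsub>E\<^esub> i) = d [^] i" if "a [^]\<^bsub>E\<^esub> i \<in> C" for i :: int
    proof -
      \<comment> \<open>Division with remainder: the power of \<open>a\<close> with exponent
        \<open>i mod int n\<close> again lies in \<open>C\<close>, so the minimality of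
        \<open>n\<close> forces the remainder to vanish.\<close>
      have split: "a [^]\<^bsub>E\<^esub> i = (a [^]\<^bsub>E\<^esub> int n) [^]\<^bsub>E\<^esub> (i div int n) \<otimes>\<^bsub>E\<^esub> a [^]\<^bsub>E\<^esub> (i mod int n)"
        using a by (simp add: E.int_pow_pow flip: E.int_pow_mult)
      then have "a [^]\<^bsub>E\<^esub> (i mod int n) =
          inv\<^bsub>E\<^esub> ((a [^]\<^bsub>E\<^esub> int n) [^]\<^bsub>E\<^esub> (i div int n)) \<otimes>\<^bsub>E\<^esub> a [^]\<^bsub>E\<^esub> i"
        using a by (simp flip: E.m_assoc)
      then have "a [^]\<^bsub>E\<^esub> (i mod int n) \<in> C"
        using subgroup.m_closed[OF C subgroup.m_inv_closed[OF C pw] that] by simp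
      then have "a [^]\<^bsub>E\<^esub> int (nat (i mod int n)) \<in> C"
        using n(1) by simp
      then have "\<not> 0 < nat (i mod int n)"
        using least[of "nat (i mod int n)"] n(1) pos_mod_bound[of "int n" i] by linarith
      then have "i mod int n = 0"
        using n(1) pos_mod_sign[of "int n" i] by linarith
      then have i: "i = int n * (i div int n)"
        by auto
      have "\<chi> (a [^]\<^bsub>E\<^esub> i) = \<chi> ((a [^]\<^bsub>E\<^esub> int n) [^]\<^bsub>E\<^esub> (i div int n))"
        by (subst i) (simp add: E.int_pow_pow a)
      also have "\<dots> = \<chi> (a [^]\<^bsub>E\<^esub> int n) [^] (i div int n)"
        using \<chi>.hom_int_pow[of "a [^]\<^bsub>E\<^esub> int n" "i div int n"] n(2)
          E.int_pow_consistent[OF C n(2)] by simp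
      also have "\<dots> = (d [^] int n) [^] (i div int n)"
        using d by (simp add: int_pow_int)
      also have "\<dots> = d [^] i"
        by (subst (2) i) (simp add: int_pow_pow d(1))
      finally show ?thesis .
    qed
    with d(1) that show ?thesis by blast
  qed
qed

text \<open>Take \<open>K\<close> to be the product of \<open>C\<close> with the powers of
  \<open>a\<close>, and send c a^i to \<chi>(c) d^i, with \<open>d\<close> from
  \<open>hom_on_powers\<close>. Commutativity of \<open>E\<close> makes \<open>K\<close> a subgroup
  and the new map multiplicative.\<close>

lemma hom_extension_insert:
  assumes "comm_group E" and C: "subgroup C E" and \<chi>: "\<chi> \<in> hom (E\<lparr>carrier := C\<rparr>) M"
    and a: "a \<in> carrier E"
  shows "\<exists>K \<psi>. subgroup K E \<and> insert a C \<subseteq> K \<and> \<psi> \<in> hom (E\<lparr>carrier := K\<rparr>) M \<and> (\<forall>c\<in>C. \<psi> c = \<chi> c)"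
proof -
  interpret E: comm_group E by fact
  obtain d where d: "d \<in> carrier M"
    and \<chi>d: "\<And>i::int. a [^]\<^bsub>E\<^esub> i \<in> C \<Longrightarrow> \<chi> (a [^]\<^bsub>E\<^esub> i) = d [^] i"
    using hom_on_powers[OF E.is_group C \<chi> a] by metis
  have CE: "c \<in> carrier E" if "c \<in> C" for c
    using subgroup.mem_carrier[OF C that] .
  have \<chi>_closed: "\<chi> c \<in> carrier M" if "c \<in> C" for c
    using \<chi> that by (auto simp: hom_def)
  have \<chi>_mult: "\<chi> (c \<otimes>\<^bsub>E\<^esub> c') = \<chi> c \<otimes> \<chi> c'" if "c \<in> C" "c' \<in> C" for c c'
    using \<chi> that by (auto simp: hom_def)
  define e where "e c i = c \<otimes>\<^bsub>E\<^esub> a [^]\<^bsub>E\<^esub> i" for c and i :: int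
  have e_mult: "e c i \<otimes>\<^bsub>E\<^esub> e c' j = e (c \<otimes>\<^bsub>E\<^esub> c') (i + j)" if "c \<in> C" "c' \<in> C" for c c' i j
    using that a by (simp add: e_def CE E.int_pow_mult E.m_ac)
  define K where "K = {e c i | c i. c \<in> C}"
  \<comment> \<open>Two expressions for one element differ by the power of \<open>a\<close> with
    exponent \<open>j - i\<close>; this power lies in \<open>C\<close>, where \<chi> agrees with the
    powers of \<open>d\<close>.\<close>
  have wd: "\<chi> c \<otimes> d [^] i = \<chi> c' \<otimes> d [^] j" if "c \<in> C" "c' \<in> C" "e c i = e c' j" for c c' i j
  proof -
    have "c = c' \<otimes>\<^bsub>E\<^esub> a [^]\<^bsub>E\<^esub> (j - i)"
      using that a CE unfolding e_def
      by (simp add: E.int_pow_diff E.m_assoc[symmetric] E.inv_solve_right)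
    moreover from this have "a [^]\<^bsub>E\<^esub> (j - i) = inv\<^bsub>E\<^esub> c' \<otimes>\<^bsub>E\<^esub> c"
      using that a CE by (simp flip: E.m_assoc)
    then have "a [^]\<^bsub>E\<^esub> (j - i) \<in> C"
      using that subgroup.m_closed[OF C subgroup.m_inv_closed[OF C]] by simp
    ultimately have "\<chi> c = \<chi> c' \<otimes> d [^] (j - i)"
      using that \<chi>d \<chi>_mult by metis
    then show ?thesis
      using that d \<chi>_closed by (simp add: m_assoc flip: int_pow_mult)
  qed
  have "\<exists>\<psi>. \<forall>c i. c \<in> C \<longrightarrow> \<psi> (e c i) = \<chi> c \<otimes> d [^] i"
  proof (intro exI allI impI)
    fix c i assume "c \<in> C"
    then have "\<exists>m c' j. c' \<in> C \<and> e c i = e c' j \<and> m = \<chi> c' \<otimes> d [^] j" by blast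
    from someI_ex[OF this]
    show "(SOME m. \<exists>c' j. c' \<in> C \<and> e c i = e c' j \<and> m = \<chi> c' \<otimes> d [^] j) = \<chi> c \<otimes> d [^] i"
      using wd[OF \<open>c \<in> C\<close>] by metis
  qed
  then obtain \<psi> where \<psi>: "\<And>c i. c \<in> C \<Longrightarrow> \<psi> (e c i) = \<chi> c \<otimes> d [^] i" by blast
  have e0: "e c 0 = c" if "c \<in> C" for c
    using that CE by (simp add: e_def)
  have "subgroup K E"
  proof (rule E.subgroupI)
    show "K \<subseteq> carrier E"
      using CE a by (auto simp: K_def e_def)
    show "K \<noteq> {}"
      using subgroup.one_closed[OF C] by (auto simp: K_def)
    fix x y assume "x \<in> K"
    then obtain c i where x: "x = e c i" and c: "c \<in> C" by (auto simp: K_def)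
    have "inv\<^bsub>E\<^esub> x = e (inv\<^bsub>E\<^esub> c) (- i)"
      using a CE c by (simp add: x e_def E.inv_mult E.int_pow_neg)
    then show "inv\<^bsub>E\<^esub> x \<in> K"
      using subgroup.m_inv_closed[OF C c] by (auto simp: K_def)
    assume "y \<in> K"
    then show "x \<otimes>\<^bsub>E\<^esub> y \<in> K"
      using x c e_mult subgroup.m_closed[OF C] unfolding K_def by blast
  qed
  moreover have "insert a C \<subseteq> K"
  proof -
    have "e \<one>\<^bsub>E\<^esub> 1 \<in> K"
      using subgroup.one_closed[OF C] by (auto simp: K_def)
    then have "a \<in> K"
      using a by (simp add: e_def E.int_pow_1)
    moreover have "c \<in> K" if "c \<in> C" for c
      unfolding K_def using that by (intro CollectI exI[of _ c] exI[of _ "0::int"] conjI) (simp_all add: e0)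
    ultimately show ?thesis
      by blast
  qed
  moreover have "\<psi> \<in> hom (E\<lparr>carrier := K\<rparr>) M"
  proof (rule homI)
    fix x assume "x \<in> carrier (E\<lparr>carrier := K\<rparr>)"
    then show "\<psi> x \<in> carrier M"
      using d \<chi>_closed by (auto simp: K_def \<psi>)
  next
    fix x y assume "x \<in> carrier (E\<lparr>carrier := K\<rparr>)" "y \<in> carrier (E\<lparr>carrier := K\<rparr>)"
    then obtain c i c' j where "x = e c i" "y = e c' j" "c \<in> C" "c' \<in> C"
      by (auto simp: K_def)
    then show "\<psi> (x \<otimes>\<^bsub>E\<lparr>carrier := K\<rparr>\<^esub> y) = \<psi> x \<otimes> \<psi> y"
      using d by (simp add: e_mult \<psi> \<chi>_mult \<chi>_closed subgroup.m_closed[OF C] int_pow_mult m_ac)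
  qed
  moreover have "\<forall>c\<in>C. \<psi> c = \<chi> c"
    using \<psi>[of _ 0] e0 \<chi>_closed by simp
  ultimately show ?thesis by blast
qed

text \<open>One element is adjoined at a time. Finiteness is asked of \<open>S\<close> and not of
  \<open>E\<close>, because the lemma is also applied to an extension of a finite group by
  \<open>M\<close>, where finitely many lifts together with the copy of \<open>M\<close> are
  enough.\<close>

lemma hom_extension_finite:
  assumes "comm_group E" and "finite S" and "S \<subseteq> carrier E"
    and "subgroup C E" and "\<chi> \<in> hom (E\<lparr>carrier := C\<rparr>) M"
  shows "\<exists>K \<psi>. subgroup K E \<and> S \<union> C \<subseteq> K \<and> \<psi> \<in> hom (E\<lparr>carrier := K\<rparr>) M \<and> (\<forall>c\<in>C. \<psi> c = \<chi> c)"
  using assms(2,3)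
proof (induction S)
  case empty
  show ?case
    using assms(4,5) by auto
next
  case (insert a S)
  then obtain K \<psi> where K: "subgroup K E" "S \<union> C \<subseteq> K" "\<psi> \<in> hom (E\<lparr>carrier := K\<rparr>) M"
    and \<psi>: "\<forall>c\<in>C. \<psi> c = \<chi> c"
    by auto
  obtain L \<phi> where "subgroup L E" "insert a K \<subseteq> L" "\<phi> \<in> hom (E\<lparr>carrier := L\<rparr>) M"
    and "\<forall>c\<in>K. \<phi> c = \<psi> c"
    using hom_extension_insert[OF assms(1) K(1,3), of a] insert.prems by auto
  then show ?case
    using K(2) \<psi> by (intro exI[of _ L] exI[of _ \<phi>]) auto
qed

text \<open>The triviality condition lets \<chi> factor through the image of \<open>C\<close> in the
  abelianization of \<open>G\<close>. There it extends by adjoining the finitely many elements of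
  the quotient, and the extension is pulled back to \<open>G\<close>.\<close>

lemma hom_extension:
  assumes "group G" and "finite (carrier G)" and C: "subgroup C G"
    and \<chi>: "\<chi> \<in> hom (G\<lparr>carrier := C\<rparr>) M"
    and triv: "\<And>c. c \<in> C \<inter> derived G (carrier G) \<Longrightarrow> \<chi> c = \<one>"
  obtains \<psi> where "\<psi> \<in> hom G M" and "\<And>c. c \<in> C \<Longrightarrow> \<psi> c = \<chi> c"
proof -
  interpret G: group G by fact
  let ?D = "derived G (carrier G)"
  let ?Q = "G Mod ?D"
  let ?p = "\<lambda>x. ?D #>\<^bsub>G\<^esub> x"
  interpret D: normal ?D G by (rule G.derived_self_is_normal)
  interpret Q: comm_group ?Q by (rule G.derived_quot_is_comm_group)
  interpret p: group_hom G ?Q ?p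
    using D.r_coset_hom_Mod by (simp add: group_hom_def group_hom_axioms_def)
  interpret \<chi>: group_hom "G\<lparr>carrier := C\<rparr>" M \<chi>
    using \<chi> G.subgroup_imp_group[OF C] by (simp add: group_hom_def group_hom_axioms_def)
  have CX: "c \<in> carrier G" if "c \<in> C" for c
    using subgroup.mem_carrier[OF C that] .
  have sub: "subgroup (?p ` C) ?Q"
    using p.subgroup_img_is_subgroup[OF C] .
  \<comment> \<open>Elements of \<open>C\<close> with the same image differ by an element of
    \<open>C\<close> in the derived subgroup, which \<chi> kills.\<close>
  have wd: "\<chi> c = \<chi> c'" if "c \<in> C" "c' \<in> C" "?p c = ?p c'" for c c'
  proof -
    have "c \<otimes>\<^bsub>G\<^esub> inv\<^bsub>G\<^esub> c' \<in> ?D"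
      using D.rcos_module_imp[OF G.is_group CX[OF that(2)]] G.rcos_self[OF CX[OF that(1)] D.is_subgroup]
        that(3) by blast
    moreover have "c \<otimes>\<^bsub>G\<^esub> inv\<^bsub>G\<^esub> c' \<in> C"
      using that C by (simp add: subgroup.m_closed subgroup.m_inv_closed)
    ultimately have "\<chi> (c \<otimes>\<^bsub>G\<^esub> inv\<^bsub>G\<^esub> c') = \<one>"
      using triv by blast
    moreover have "\<chi> (c \<otimes>\<^bsub>G\<^esub> inv\<^bsub>G\<^esub> c') = \<chi> c \<otimes> inv (\<chi> c')"
      using \<chi>.hom_mult[of c "inv\<^bsub>G\<^esub> c'"] \<chi>.hom_inv[of c'] that
        subgroup.m_inv_closed[OF C] G.m_inv_consistent[OF C] by simp
    ultimately show ?thesis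
      using that \<chi>.hom_closed by (simp add: inv_solve_right')
  qed
  obtain \<phi> where \<phi>: "\<And>c. c \<in> C \<Longrightarrow> \<chi> c = \<phi> (?p c)"
    using function_factors_left_gen[of "\<lambda>c. c \<in> C" ?p \<chi>] wd by blast
  have "\<phi> \<in> hom (?Q\<lparr>carrier := ?p ` C\<rparr>) M"
  proof (rule homI)
    fix u v assume "u \<in> carrier (?Q\<lparr>carrier := ?p ` C\<rparr>)" "v \<in> carrier (?Q\<lparr>carrier := ?p ` C\<rparr>)"
    then obtain c c' where c: "u = ?p c" "v = ?p c'" "c \<in> C" "c' \<in> C" by auto
    then have "u \<otimes>\<^bsub>?Q\<lparr>carrier := ?p ` C\<rparr>\<^esub> v = ?p (c \<otimes>\<^bsub>G\<^esub> c')"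
      using p.hom_mult CX by simp
    then show "\<phi> (u \<otimes>\<^bsub>?Q\<lparr>carrier := ?p ` C\<rparr>\<^esub> v) = \<phi> u \<otimes> \<phi> v"
      using c \<chi>.hom_mult[of c c'] subgroup.m_closed[OF C] by (simp flip: \<phi>)
  qed (use \<chi>.hom_closed \<phi> in auto)
  moreover have "finite (carrier ?Q)"
    using assms(2) by (simp add: carrier_FactGroup)
  ultimately obtain K \<psi> where K: "subgroup K ?Q" "carrier ?Q \<union> ?p ` C \<subseteq> K"
    and \<psi>: "\<psi> \<in> hom (?Q\<lparr>carrier := K\<rparr>) M" "\<forall>u\<in>?p ` C. \<psi> u = \<phi> u"
    using hom_extension_finite[OF Q.comm_group_axioms _ order.refl sub] by blast
  have "K = carrier ?Q"
    using K subgroup.subset by blast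
  then have "\<psi> \<in> hom ?Q M"
    using \<psi>(1) by (simp add: hom_def)
  then have "\<psi> \<circ> ?p \<in> hom G M"
    by (rule Group.hom_compose[OF p.homh])
  moreover have "(\<psi> \<circ> ?p) c = \<chi> c" if "c \<in> C" for c
    using that \<psi>(2) \<phi> by simp
  ultimately show thesis
    using that by blast
qed

end

section \<open>Splitting of cocycles\<close>

text \<open>The condition of \<open>cocycles2\<close> in curried form, without any demand on values
  outside the carrier, so that pullbacks along homomorphisms are again cocycles without being
  restricted.\<close>

definition cocycle :: "('a, 'm) monoid_scheme \<Rightarrow> ('c, 'k) monoid_scheme \<Rightarrow> ('a \<Rightarrow> 'a \<Rightarrow> 'c) \<Rightarrow> bool"
  where "cocycle G M f \<longleftrightarrow>
    (\<forall>x\<in>carrier G. \<forall>y\<in>carrier G. f x y \<in> carrier M) \<and>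
    (\<forall>x\<in>carrier G. \<forall>y\<in>carrier G. \<forall>z\<in>carrier G.
      f y z \<otimes>\<^bsub>M\<^esub> f x (y \<otimes>\<^bsub>G\<^esub> z) = f (x \<otimes>\<^bsub>G\<^esub> y) z \<otimes>\<^bsub>M\<^esub> f x y)"

text \<open>This says that \<open>f\<close> is the coboundary of \<open>g\<close>; the inverse has
  been moved to the other side to keep calculations free of inverses.\<close>

definition cocycle_splits :: "('a, 'm) monoid_scheme \<Rightarrow> ('c, 'k) monoid_scheme \<Rightarrow> ('a \<Rightarrow> 'a \<Rightarrow> 'c) \<Rightarrow> bool"
  where "cocycle_splits G M f \<longleftrightarrow>
    (\<exists>g\<in>carrier G \<rightarrow> carrier M. \<forall>x\<in>carrier G. \<forall>y\<in>carrier G.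
      f x y \<otimes>\<^bsub>M\<^esub> g (x \<otimes>\<^bsub>G\<^esub> y) = g x \<otimes>\<^bsub>M\<^esub> g y)"

definition symmetric_on_commuting :: "('a, 'm) monoid_scheme \<Rightarrow> ('a \<Rightarrow> 'a \<Rightarrow> 'c) \<Rightarrow> bool"
  where "symmetric_on_commuting G f \<longleftrightarrow>
    (\<forall>x\<in>carrier G. \<forall>y\<in>carrier G. x \<otimes>\<^bsub>G\<^esub> y = y \<otimes>\<^bsub>G\<^esub> x \<longrightarrow> f x y = f y x)"

text \<open>For finite \<open>G\<close> and coefficients \<open>rat_mod_int\<close> this is
  triviality of the Bogomolov multiplier, as shown in
  \<open>trivial_bogomolov_multiplier_iff\<close>.\<close>

definition commuting_symmetric_split :: "('a, 'm) monoid_scheme \<Rightarrow> ('c, 'k) monoid_scheme \<Rightarrow> bool"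
  where "commuting_symmetric_split G M \<longleftrightarrow>
    (\<forall>f. cocycle G M f \<longrightarrow> symmetric_on_commuting G f \<longrightarrow> cocycle_splits G M f)"

locale group_cocycle = G: group G + M: comm_group M
  for G :: "('a, 'm) monoid_scheme" (structure) and M :: "('c, 'k) monoid_scheme"
    and f :: "'a \<Rightarrow> 'a \<Rightarrow> 'c" +
  assumes cocycle: "cocycle G M f"
begin

lemma closed [simp]: "x \<in> carrier G \<Longrightarrow> y \<in> carrier G \<Longrightarrow> f x y \<in> carrier M"
  using cocycle by (simp add: cocycle_def)

lemma cocycle_eq:
  "\<lbrakk>x \<in> carrier G; y \<in> carrier G; z \<in> carrier G\<rbrakk> \<Longrightarrow>
    f y z \<otimes>\<^bsub>M\<^esub> f x (y \<otimes> z) = f (x \<otimes> y) z \<otimes>\<^bsub>M\<^esub> f x y"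
  using cocycle by (simp add: cocycle_def)

text \<open>Cocycles are not assumed to be normalised. Their constant value along the unit appears
  as the correction factor \<open>k\<close> in later constructions.\<close>

lemma one_left: "y \<in> carrier G \<Longrightarrow> f \<one> y = f \<one> \<one>"
  using cocycle_eq[of \<one> \<one> y] by simp

lemma one_right: "x \<in> carrier G \<Longrightarrow> f x \<one> = f \<one> \<one>"
  using cocycle_eq[of x \<one> \<one>] by (simp add: M.m_comm)

text \<open>In the extension with factor set \<open>f\<close>, the two sides are the factors from
  \<open>M\<close> that arise when the lifts of x, y, u, v are multiplied as (xy)(uv) and as
  (xu)(yv). The products agree because \<open>comm\<close> says that the lifts of \<open>y\<close>
  and \<open>u\<close> commute.\<close>

lemma interchange:
  assumes "x \<in> carrier G" "y \<in> carrier G" "u \<in> carrier G" "v \<in> carrier G"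
    and comm: "y \<otimes> u = u \<otimes> y" "f y u = f u y"
  shows "f x y \<otimes>\<^bsub>M\<^esub> f u v \<otimes>\<^bsub>M\<^esub> f (x \<otimes> y) (u \<otimes> v) = f x u \<otimes>\<^bsub>M\<^esub> f y v \<otimes>\<^bsub>M\<^esub> f (x \<otimes> u) (y \<otimes> v)"
proof -
  note [simp] = assms(1-4)
  have eq: "y \<otimes> (u \<otimes> v) = u \<otimes> (y \<otimes> v)"
    using comm(1) by (simp flip: G.m_assoc)
  have "f x y \<otimes>\<^bsub>M\<^esub> f u v \<otimes>\<^bsub>M\<^esub> f (x \<otimes> y) (u \<otimes> v) = f u v \<otimes>\<^bsub>M\<^esub> (f (x \<otimes> y) (u \<otimes> v) \<otimes>\<^bsub>M\<^esub> f x y)"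
    by (simp add: M.m_ac)
  also have "\<dots> = f u v \<otimes>\<^bsub>M\<^esub> (f y (u \<otimes> v) \<otimes>\<^bsub>M\<^esub> f x (y \<otimes> (u \<otimes> v)))"
    by (simp only: cocycle_eq[of x y "u \<otimes> v"] assms G.m_closed)
  also have "\<dots> = (f u v \<otimes>\<^bsub>M\<^esub> f y (u \<otimes> v)) \<otimes>\<^bsub>M\<^esub> f x (y \<otimes> (u \<otimes> v))"
    by (simp add: M.m_assoc)
  also have "\<dots> = (f (u \<otimes> y) v \<otimes>\<^bsub>M\<^esub> f u y) \<otimes>\<^bsub>M\<^esub> f x (u \<otimes> (y \<otimes> v))"
    using cocycle_eq[of y u v] by (simp add: comm eq)
  also have "\<dots> = (f y v \<otimes>\<^bsub>M\<^esub> f u (y \<otimes> v)) \<otimes>\<^bsub>M\<^esub> f x (u \<otimes> (y \<otimes> v))"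
    using cocycle_eq[of u y v] by simp
  also have "\<dots> = f y v \<otimes>\<^bsub>M\<^esub> (f u (y \<otimes> v) \<otimes>\<^bsub>M\<^esub> f x (u \<otimes> (y \<otimes> v)))"
    by (simp add: M.m_assoc)
  also have "\<dots> = f y v \<otimes>\<^bsub>M\<^esub> (f (x \<otimes> u) (y \<otimes> v) \<otimes>\<^bsub>M\<^esub> f x u)"
    using cocycle_eq[of x u "y \<otimes> v"] by simp
  also have "\<dots> = f x u \<otimes>\<^bsub>M\<^esub> f y v \<otimes>\<^bsub>M\<^esub> f (x \<otimes> u) (y \<otimes> v)"
    by (simp add: M.m_ac)
  finally show ?thesis .
qed

end

section \<open>Splitting of cocycles on finite abelian groups and on direct products\<close>

context divisible_group
begin

text \<open>Symmetry makes the extension \<open>E\<close> of \<open>A\<close> by \<open>M\<close>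
  abelian. Since \<open>M\<close> is divisible, the identity of the copy of \<open>M\<close> inside
  \<open>E\<close> extends to a homomorphism \<psi> defined on all lifts (a, \<one>), and the values
  of \<psi> on these lifts split \<open>f\<close>.\<close>

lemma symmetric_cocycle_splits:
  assumes "comm_group A" and fin: "finite (carrier A)" and f: "cocycle A M f"
    and sym: "symmetric_on_commuting A f"
  shows "cocycle_splits A M f"
proof -
  interpret A: comm_group A by fact
  interpret f: group_cocycle A M f
    using f by unfold_locales
  define k where "k = f \<one>\<^bsub>A\<^esub> \<one>\<^bsub>A\<^esub>"
  have [simp]: "k \<in> carrier M"
    by (simp add: k_def)
  have [simp]: "f \<one>\<^bsub>A\<^esub> a = k" "f a \<one>\<^bsub>A\<^esub> = k" if "a \<in> carrier A" for a
    using f.one_left[OF that] f.one_right[OF that] by (simp_all add: k_def)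
  \<comment> \<open>the extension of \<open>A\<close> by \<open>M\<close> with factor set \<open>f\<close>; its unit is not \<open>(\<one>, \<one>)\<close> since \<open>f\<close> need not be normalised\<close>
  define E where "E = \<lparr>carrier = carrier A \<times> carrier M,
    monoid.mult = (\<lambda>(a, d) (b, e). (a \<otimes>\<^bsub>A\<^esub> b, f a b \<otimes> (d \<otimes> e))), one = (\<one>\<^bsub>A\<^esub>, inv k)\<rparr>"
  have mult [simp]: "(a, d) \<otimes>\<^bsub>E\<^esub> (b, e) = (a \<otimes>\<^bsub>A\<^esub> b, f a b \<otimes> (d \<otimes> e))" for a b d e
    by (simp add: E_def)
  have carrier [simp]: "carrier E = carrier A \<times> carrier M"
    by (simp add: E_def)
  have one [simp]: "\<one>\<^bsub>E\<^esub> = (\<one>\<^bsub>A\<^esub>, inv k)"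
    by (simp add: E_def)
  have cancel [simp]: "x \<otimes> (inv x \<otimes> y) = y" "inv x \<otimes> (x \<otimes> y) = y" if "x \<in> carrier M" "y \<in> carrier M" for x y
    using that by (simp_all flip: m_assoc)
  have "comm_group E"
  proof (rule comm_groupI)
    fix p q r assume "p \<in> carrier E" "q \<in> carrier E" "r \<in> carrier E"
    then obtain a d b e c h where pqr: "p = (a, d)" "q = (b, e)" "r = (c, h)"
      and in_A [simp]: "a \<in> carrier A" "b \<in> carrier A" "c \<in> carrier A"
      and in_M [simp]: "d \<in> carrier M" "e \<in> carrier M" "h \<in> carrier M"
      by auto
    have "f (a \<otimes>\<^bsub>A\<^esub> b) c \<otimes> (f a b \<otimes> (d \<otimes> e) \<otimes> h) = (f (a \<otimes>\<^bsub>A\<^esub> b) c \<otimes> f a b) \<otimes> (d \<otimes> (e \<otimes> h))"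
      by (simp add: m_assoc)
    also have "\<dots> = (f b c \<otimes> f a (b \<otimes>\<^bsub>A\<^esub> c)) \<otimes> (d \<otimes> (e \<otimes> h))"
      by (simp add: f.cocycle_eq)
    also have "\<dots> = f a (b \<otimes>\<^bsub>A\<^esub> c) \<otimes> (d \<otimes> (f b c \<otimes> (e \<otimes> h)))"
      by (simp add: m_ac)
    finally show "p \<otimes>\<^bsub>E\<^esub> q \<otimes>\<^bsub>E\<^esub> r = p \<otimes>\<^bsub>E\<^esub> (q \<otimes>\<^bsub>E\<^esub> r)"
      by (simp add: pqr A.m_assoc)
  next
    fix p q assume "p \<in> carrier E" "q \<in> carrier E"
    then show "p \<otimes>\<^bsub>E\<^esub> q = q \<otimes>\<^bsub>E\<^esub> p"
      using sym by (auto simp: A.m_comm m_comm symmetric_on_commuting_def)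
  next
    fix p assume "p \<in> carrier E"
    then obtain a d where p: "p = (a, d)" and [simp]: "a \<in> carrier A" "d \<in> carrier M" by auto
    define e where "e = inv (f (inv\<^bsub>A\<^esub> a) a) \<otimes> (inv d \<otimes> inv k)"
    have "f (inv\<^bsub>A\<^esub> a) a \<otimes> (e \<otimes> d) = inv k"
      by (simp add: e_def m_assoc m_comm[of "inv k" d])
    then have "(inv\<^bsub>A\<^esub> a, e) \<otimes>\<^bsub>E\<^esub> p = \<one>\<^bsub>E\<^esub>"
      by (simp add: p)
    then show "\<exists>q\<in>carrier E. q \<otimes>\<^bsub>E\<^esub> p = \<one>\<^bsub>E\<^esub>"
      by (rule bexI) (simp add: e_def)
  qed auto
  then interpret E: comm_group E .
  define C where "C = {\<one>\<^bsub>A\<^esub>} \<times> carrier M"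
  have C: "subgroup C E"
  proof (rule E.subgroupI)
    fix p assume "p \<in> C"
    then obtain d where p: "p = (\<one>\<^bsub>A\<^esub>, d)" and [simp]: "d \<in> carrier M" by (auto simp: C_def)
    have "inv\<^bsub>E\<^esub> p = (\<one>\<^bsub>A\<^esub>, inv d \<otimes> (inv k \<otimes> inv k))"
    proof (rule E.inv_equality)
      have "inv d \<otimes> (inv k \<otimes> inv k) \<otimes> d = inv k \<otimes> inv k"
        using m_comm[of "inv d \<otimes> (inv k \<otimes> inv k)" d] by simp
      then show "(\<one>\<^bsub>A\<^esub>, inv d \<otimes> (inv k \<otimes> inv k)) \<otimes>\<^bsub>E\<^esub> p = \<one>\<^bsub>E\<^esub>"
        by (simp add: p)
    qed (auto simp: p)
    then show "inv\<^bsub>E\<^esub> p \<in> C"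
      by (simp add: C_def)
  qed (auto simp: C_def)
  \<comment> \<open>The unit of \<open>E\<close> has second component \<open>inv k\<close>, so
    \<open>M\<close> embeds by sending \<open>d\<close> to (\<one>, inv k \<otimes> d). The factor
    \<open>k\<close> inverts this embedding.\<close>
  have hom: "(\<lambda>(a, d). k \<otimes> d) \<in> hom (E\<lparr>carrier := C\<rparr>) M"
    by (rule homI) (auto simp: C_def m_ac)
  have "finite ((\<lambda>a. (a, \<one>)) ` carrier A)" "(\<lambda>a. (a, \<one>)) ` carrier A \<subseteq> carrier E"
    using fin by auto
  from hom_extension_finite[OF E.comm_group_axioms this C hom] obtain K \<psi> where K: "subgroup K E" "(\<lambda>a. (a, \<one>)) ` carrier A \<union> C \<subseteq> K"
    and \<psi>: "\<psi> \<in> hom (E\<lparr>carrier := K\<rparr>) M" "\<forall>c\<in>C. \<psi> c = (case c of (a, d) \<Rightarrow> k \<otimes> d)"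
    by blast
  have mult_\<psi>: "\<psi> (p \<otimes>\<^bsub>E\<^esub> q) = \<psi> p \<otimes> \<psi> q" if "p \<in> K" "q \<in> K" for p q
    using \<psi>(1) that by (simp add: hom_def)
  define g where "g a = \<psi> (a, \<one>)" for a
  have AK: "(a, \<one>) \<in> K" if "a \<in> carrier A" for a
    using K(2) that by auto
  have g: "g a \<in> carrier M" if "a \<in> carrier A" for a
    using \<psi>(1) AK[OF that] by (auto simp: hom_def g_def)
  have "f a b \<otimes> g (a \<otimes>\<^bsub>A\<^esub> b) = g a \<otimes> g b" if [simp]: "a \<in> carrier A" "b \<in> carrier A" for a b
  proof -
    \<comment> \<open>This is the image of \<open>f a b\<close> under the embedding of
      \<open>M\<close>; multiplied by the lift of the product of \<open>a\<close> and
      \<open>b\<close>, it gives the product of their lifts.\<close>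
    have c: "(\<one>\<^bsub>A\<^esub>, inv k \<otimes> f a b) \<in> C"
      by (simp add: C_def)
    have "f a b \<otimes> g (a \<otimes>\<^bsub>A\<^esub> b) = \<psi> (\<one>\<^bsub>A\<^esub>, inv k \<otimes> f a b) \<otimes> \<psi> (a \<otimes>\<^bsub>A\<^esub> b, \<one>)"
      using \<psi>(2) c by (simp add: g_def)
    also have "\<dots> = \<psi> ((\<one>\<^bsub>A\<^esub>, inv k \<otimes> f a b) \<otimes>\<^bsub>E\<^esub> (a \<otimes>\<^bsub>A\<^esub> b, \<one>))"
      using c K(2) AK[of "a \<otimes>\<^bsub>A\<^esub> b"] mult_\<psi> by (metis A.m_closed Un_subset_iff subsetD that)
    also have "\<dots> = \<psi> ((a, \<one>) \<otimes>\<^bsub>E\<^esub> (b, \<one>))"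
      by simp
    also have "\<dots> = g a \<otimes> g b"
      using AK mult_\<psi> unfolding g_def by (simp del: mult)
    finally show ?thesis .
  qed
  with g show ?thesis
    unfolding cocycle_splits_def by blast
qed

text \<open>Restrict \<open>f\<close> to both factors and split it there by \<open>gH\<close> and
  \<open>gN\<close>. Elements of different factors commute, so by symmetry of \<open>f\<close> their
  lifts commute too, and the two splittings can be glued.\<close>

lemma commuting_symmetric_split_DirProd:
  assumes "group H" "group N"
    and TH: "commuting_symmetric_split H M" and TN: "commuting_symmetric_split N M"
  shows "commuting_symmetric_split (H \<times>\<times> N) M"
  unfolding commuting_symmetric_split_def
proof (intro allI impI)
  fix f assume f: "cocycle (H \<times>\<times> N) M f" and sym: "symmetric_on_commuting (H \<times>\<times> N) f"
  interpret H: group H by fact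
  interpret N: group N by fact
  interpret HN: group "H \<times>\<times> N" using DirProd_group assms(1,2) .
  interpret f: group_cocycle "H \<times>\<times> N" M f
    using f by unfold_locales
  let ?fH = "\<lambda>h h'. f (h, \<one>\<^bsub>N\<^esub>) (h', \<one>\<^bsub>N\<^esub>)" and ?fN = "\<lambda>n n'. f (\<one>\<^bsub>H\<^esub>, n) (\<one>\<^bsub>H\<^esub>, n')"
  have "cocycle H M ?fH"
    using f.cocycle_eq[of "(_, \<one>\<^bsub>N\<^esub>)" "(_, \<one>\<^bsub>N\<^esub>)" "(_, \<one>\<^bsub>N\<^esub>)"] by (simp add: cocycle_def)
  moreover have "symmetric_on_commuting H ?fH"
    using sym by (simp add: symmetric_on_commuting_def)
  ultimately have "cocycle_splits H M ?fH"
    using TH by (simp add: commuting_symmetric_split_def)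
  then obtain gH where gH: "gH \<in> carrier H \<rightarrow> carrier M"
    and fH: "\<And>x y. x \<in> carrier H \<Longrightarrow> y \<in> carrier H \<Longrightarrow> ?fH x y \<otimes> gH (x \<otimes>\<^bsub>H\<^esub> y) = gH x \<otimes> gH y"
    unfolding cocycle_splits_def by blast
  have "cocycle N M ?fN"
    using f.cocycle_eq[of "(\<one>\<^bsub>H\<^esub>, _)" "(\<one>\<^bsub>H\<^esub>, _)" "(\<one>\<^bsub>H\<^esub>, _)"] by (simp add: cocycle_def)
  moreover have "symmetric_on_commuting N ?fN"
    using sym by (simp add: symmetric_on_commuting_def)
  ultimately have "cocycle_splits N M ?fN"
    using TN by (simp add: commuting_symmetric_split_def)
  then obtain gN where gN: "gN \<in> carrier N \<rightarrow> carrier M"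
    and fN: "\<And>x y. x \<in> carrier N \<Longrightarrow> y \<in> carrier N \<Longrightarrow> ?fN x y \<otimes> gN (x \<otimes>\<^bsub>N\<^esub> y) = gN x \<otimes> gN y"
    unfolding cocycle_splits_def by blast
  define t where "t h n = f (h, \<one>\<^bsub>N\<^esub>) (\<one>\<^bsub>H\<^esub>, n)" for h n
  have [simp]: "\<And>h. h \<in> carrier H \<Longrightarrow> gH h \<in> carrier M" "\<And>n. n \<in> carrier N \<Longrightarrow> gN n \<in> carrier M"
    "\<And>h n. h \<in> carrier H \<Longrightarrow> n \<in> carrier N \<Longrightarrow> t h n \<in> carrier M"
    using gH gN by (auto simp: t_def)
  \<comment> \<open>in the extension of \<open>H \<times> N\<close> by \<open>M\<close>, the product of the lifts of \<open>h\<close> and \<open>n\<close> is a homomorphic lift of \<open>(h, n)\<close>\<close>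
  define g where "g = (\<lambda>(h, n). gH h \<otimes> gN n \<otimes> inv (t h n))"
  have "f (h, n) (h', n') \<otimes> g (h \<otimes>\<^bsub>H\<^esub> h', n \<otimes>\<^bsub>N\<^esub> n') = g (h, n) \<otimes> g (h', n')"
    if [simp]: "h \<in> carrier H" "n \<in> carrier N" "h' \<in> carrier H" "n' \<in> carrier N" for h n h' n'
  proof -
    let ?F = "f (h, n) (h', n')"
    \<comment> \<open>The only place where symmetry across the two factors enters: it provides the
      premise of \<open>interchange\<close> for the two inner elements.\<close>
    have "f (\<one>\<^bsub>H\<^esub>, n) (h', \<one>\<^bsub>N\<^esub>) = f (h', \<one>\<^bsub>N\<^esub>) (\<one>\<^bsub>H\<^esub>, n)"
      using sym by (simp add: symmetric_on_commuting_def)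
    then have ic: "t h n \<otimes> t h' n' \<otimes> ?F = ?fH h h' \<otimes> ?fN n n' \<otimes> t (h \<otimes>\<^bsub>H\<^esub> h') (n \<otimes>\<^bsub>N\<^esub> n')"
      using f.interchange[of "(h, \<one>\<^bsub>N\<^esub>)" "(\<one>\<^bsub>H\<^esub>, n)" "(h', \<one>\<^bsub>N\<^esub>)" "(\<one>\<^bsub>H\<^esub>, n')"] by (simp add: t_def)
    have "t h n \<otimes> t h' n' \<otimes> (?F \<otimes> (gH (h \<otimes>\<^bsub>H\<^esub> h') \<otimes> gN (n \<otimes>\<^bsub>N\<^esub> n'))) =
        (t h n \<otimes> t h' n' \<otimes> ?F) \<otimes> (gH (h \<otimes>\<^bsub>H\<^esub> h') \<otimes> gN (n \<otimes>\<^bsub>N\<^esub> n'))"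
      by (simp add: m_assoc)
    also have "\<dots> = (?fH h h' \<otimes> gH (h \<otimes>\<^bsub>H\<^esub> h')) \<otimes> (?fN n n' \<otimes> gN (n \<otimes>\<^bsub>N\<^esub> n')) \<otimes> t (h \<otimes>\<^bsub>H\<^esub> h') (n \<otimes>\<^bsub>N\<^esub> n')"
      unfolding ic by (simp add: m_ac)
    also have "\<dots> = gH h \<otimes> gH h' \<otimes> (gN n \<otimes> gN n') \<otimes> t (h \<otimes>\<^bsub>H\<^esub> h') (n \<otimes>\<^bsub>N\<^esub> n')"
      by (simp add: fH fN)
    finally have "?F \<otimes> (gH (h \<otimes>\<^bsub>H\<^esub> h') \<otimes> gN (n \<otimes>\<^bsub>N\<^esub> n')) =
        inv (t h n \<otimes> t h' n') \<otimes> (gH h \<otimes> gH h' \<otimes> (gN n \<otimes> gN n') \<otimes> t (h \<otimes>\<^bsub>H\<^esub> h') (n \<otimes>\<^bsub>N\<^esub> n'))"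
      by (simp add: inv_solve_left)
    then have "?F \<otimes> (gH (h \<otimes>\<^bsub>H\<^esub> h') \<otimes> gN (n \<otimes>\<^bsub>N\<^esub> n')) =
        inv (t h n \<otimes> t h' n') \<otimes> (gH h \<otimes> gH h' \<otimes> (gN n \<otimes> gN n')) \<otimes> t (h \<otimes>\<^bsub>H\<^esub> h') (n \<otimes>\<^bsub>N\<^esub> n')"
      by (simp add: m_assoc)
    then have "?F \<otimes> (gH (h \<otimes>\<^bsub>H\<^esub> h') \<otimes> gN (n \<otimes>\<^bsub>N\<^esub> n')) \<otimes> inv (t (h \<otimes>\<^bsub>H\<^esub> h') (n \<otimes>\<^bsub>N\<^esub> n')) =
        inv (t h n \<otimes> t h' n') \<otimes> (gH h \<otimes> gH h' \<otimes> (gN n \<otimes> gN n'))"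
      by (simp add: inv_solve_right')
    then show ?thesis
      by (simp add: g_def inv_mult m_ac)
  qed
  then show "cocycle_splits (H \<times>\<times> N) M f"
    unfolding cocycle_splits_def by (intro bexI[of _ g]) (auto simp: g_def)
qed

end

section \<open>Central quotients\<close>

text \<open>A condition on characters of \<open>C\<close> that turns the question about
  \<open>G Mod C\<close> into one about commutators of \<open>G\<close>; the next two results derive
  it from, and turn it into, splitting on the quotient.\<close>

definition commutator_detecting ::
  "('a, 'm) monoid_scheme \<Rightarrow> 'a set \<Rightarrow> ('c, 'k) monoid_scheme \<Rightarrow> bool"
  where "commutator_detecting G C M \<longleftrightarrow>
    (\<forall>\<chi>\<in>hom (G\<lparr>carrier := C\<rparr>) M.
      (\<forall>c\<in>C \<inter> commutators G. \<chi> c = \<one>\<^bsub>M\<^esub>) \<longrightarrow> (\<forall>c\<in>C \<inter> derived G (carrier G). \<chi> c = \<one>\<^bsub>M\<^esub>))"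

section \<open>Commutators, derived subgroups and central subgroups\<close>

lemma commutatorI:
  "x \<in> carrier G \<Longrightarrow> y \<in> carrier G \<Longrightarrow>
    inv\<^bsub>G\<^esub> x \<otimes>\<^bsub>G\<^esub> inv\<^bsub>G\<^esub> y \<otimes>\<^bsub>G\<^esub> x \<otimes>\<^bsub>G\<^esub> y \<in> commutators G"
  unfolding commutators_def by blast

lemma (in group) commutators_subset_derived: "commutators G \<subseteq> derived G (carrier G)"
  unfolding commutators_eq_derived_set derived_def by (blast intro: generate.incl)

lemma (in group_hom) hom_derived:
  assumes "c \<in> derived G (carrier G)"
  shows "h c \<in> derived H (carrier H)"
proof -
  have "h c \<in> derived H (h ` carrier G)"
    using derived_img[of "carrier G"] assms by blast
  also have "\<dots> \<subseteq> derived H (carrier H)"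
    by (intro H.mono_derived) auto
  finally show ?thesis .
qed

lemma (in group) hom_comm_group_derived:
  assumes "comm_group M" and \<psi>: "\<psi> \<in> hom G M" and c: "c \<in> derived G (carrier G)"
  shows "\<psi> c = \<one>\<^bsub>M\<^esub>"
proof -
  interpret M: comm_group M by fact
  interpret \<psi>: group_hom G M \<psi>
    using \<psi> by unfold_locales
  show ?thesis
    using \<psi>.hom_derived[OF c] M.derived_eq_singleton by auto
qed

lemma (in group) central_subgroup_normal:
  assumes C: "subgroup C G" and central: "C \<subseteq> center G"
  shows "C \<lhd> G"
proof -
  have "c \<otimes> x = x \<otimes> c" if "c \<in> C" "x \<in> carrier G" for c x
    using that central by (auto simp: center_def)
  with C show ?thesis
    by (intro normalI) (auto simp: r_coset_def l_coset_def)
qed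

text \<open>Transgression: composing \<chi> with the factor set of a section of \<open>G\<close>
  over \<open>G Mod C\<close> gives a cocycle on the quotient. It is symmetric on commuting pairs
  because \<chi> kills the commutators in \<open>C\<close>. A splitting of it extends \<chi> to a
  homomorphism on \<open>G\<close>, which must kill the derived subgroup.\<close>

lemma (in group) commutator_detecting_if_quotient_split:
  assumes C: "subgroup C G" and central: "C \<subseteq> center G" and "comm_group M"
    and split: "commuting_symmetric_split (G Mod C) M"
  shows "commutator_detecting G C M"
  unfolding commutator_detecting_def
proof (intro ballI impI)
  interpret M: comm_group M by fact
  fix \<chi> c\<^sub>0
  assume \<chi>: "\<chi> \<in> hom (G\<lparr>carrier := C\<rparr>) M" and triv: "\<forall>c\<in>C \<inter> commutators G. \<chi> c = \<one>\<^bsub>M\<^esub>"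
    and c\<^sub>0: "c\<^sub>0 \<in> C \<inter> derived G (carrier G)"
  have CG [simp]: "c \<in> carrier G" if "c \<in> C" for c
    using subgroup.mem_carrier[OF C that] .
  have comm: "c \<otimes> x = x \<otimes> c" if "c \<in> C" "x \<in> carrier G" for c x
    using that central by (auto simp: center_def)
  have [simp]: "c \<otimes> d \<in> C" if "c \<in> C" "d \<in> C" for c d
    using subgroup.m_closed[OF C that] .
  have [simp]: "inv c \<in> C" if "c \<in> C" for c
    using subgroup.m_inv_closed[OF C that] .
  have \<chi>_closed [simp]: "\<chi> c \<in> carrier M" if "c \<in> C" for c
    using \<chi> that by (auto simp: hom_def)
  have \<chi>_mult [simp]: "\<chi> (c \<otimes> d) = \<chi> c \<otimes>\<^bsub>M\<^esub> \<chi> d" if "c \<in> C" "d \<in> C" for c d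
    using \<chi> that by (auto simp: hom_def)
  interpret C: normal C G
    using central_subgroup_normal[OF C central] .
  interpret Q: group "G Mod C" by (rule C.factorgroup_is_group)
  let ?Q = "G Mod C"
  have p_mult: "(C #> x) \<otimes>\<^bsub>?Q\<^esub> (C #> y) = C #> (x \<otimes> y)" if "x \<in> carrier G" "y \<in> carrier G" for x y
    using C.rcos_sum that by simp
  define s where "s q = (SOME x. x \<in> carrier G \<and> C #> x = q)" for q
  have s: "s q \<in> carrier G" "C #> s q = q" if "q \<in> carrier ?Q" for q
  proof -
    have "\<exists>x. x \<in> carrier G \<and> C #> x = q"
      using that by (auto simp: carrier_FactGroup)
    from someI_ex[OF this] show "s q \<in> carrier G" "C #> s q = q"
      by (simp_all add: s_def)
  qed
  note [simp] = s(1)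
  have in_C: "x \<otimes> inv y \<in> C" if "x \<in> carrier G" "y \<in> carrier G" "C #> x = C #> y" for x y
    using C.rcos_module_imp[OF is_group that(2)] rcos_self[OF that(1) C] that(3) by blast
  \<comment> \<open>The factor set of the section \<open>s\<close>, measuring its failure to be
    multiplicative.\<close>
  define \<kappa> where "\<kappa> p q = s p \<otimes> s q \<otimes> inv (s (p \<otimes>\<^bsub>?Q\<^esub> q))" for p q
  have \<kappa> [simp]: "\<kappa> p q \<in> C" if "p \<in> carrier ?Q" "q \<in> carrier ?Q" for p q
    unfolding \<kappa>_def
    by (intro in_C) (use that in \<open>simp_all del: mult_FactGroup add: s flip: p_mult\<close>)
  have s_mult: "s p \<otimes> s q = \<kappa> p q \<otimes> s (p \<otimes>\<^bsub>?Q\<^esub> q)" if "p \<in> carrier ?Q" "q \<in> carrier ?Q" for p q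
    using that by (simp add: \<kappa>_def m_assoc del: mult_FactGroup)
  have \<kappa>_eq: "\<kappa> q r \<otimes> \<kappa> p (q \<otimes>\<^bsub>?Q\<^esub> r) = \<kappa> (p \<otimes>\<^bsub>?Q\<^esub> q) r \<otimes> \<kappa> p q"
    if [simp]: "p \<in> carrier ?Q" "q \<in> carrier ?Q" "r \<in> carrier ?Q" for p q r
  proof -
    \<comment> \<open>Multiplied by \<open>?t\<close>, both sides become s(p) s(q) s(r), evaluated
      with the two bracketings; centrality of \<open>C\<close> moves the factors into place.\<close>
    let ?t = "s (p \<otimes>\<^bsub>?Q\<^esub> q \<otimes>\<^bsub>?Q\<^esub> r)"
    have "\<kappa> q r \<otimes> \<kappa> p (q \<otimes>\<^bsub>?Q\<^esub> r) \<otimes> ?t = \<kappa> q r \<otimes> (s p \<otimes> s (q \<otimes>\<^bsub>?Q\<^esub> r))"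
      by (simp add: s_mult Q.m_assoc m_assoc del: mult_FactGroup)
    also have "\<dots> = s p \<otimes> (\<kappa> q r \<otimes> s (q \<otimes>\<^bsub>?Q\<^esub> r))"
      using comm[of "\<kappa> q r" "s p"] by (simp del: mult_FactGroup flip: m_assoc)
    also have "\<dots> = s p \<otimes> s q \<otimes> s r"
      by (simp add: m_assoc s_mult[of q r] del: mult_FactGroup)
    also have "\<dots> = \<kappa> p q \<otimes> (s (p \<otimes>\<^bsub>?Q\<^esub> q) \<otimes> s r)"
      by (simp add: s_mult[of p q] m_assoc del: mult_FactGroup)
    also have "\<dots> = \<kappa> p q \<otimes> \<kappa> (p \<otimes>\<^bsub>?Q\<^esub> q) r \<otimes> ?t"
      by (simp add: s_mult m_assoc del: mult_FactGroup)
    also have "\<dots> = \<kappa> (p \<otimes>\<^bsub>?Q\<^esub> q) r \<otimes> \<kappa> p q \<otimes> ?t"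
      by (simp add: comm[of "\<kappa> p q"] del: mult_FactGroup)
    finally show ?thesis
      by (simp del: mult_FactGroup)
  qed
  let ?f = "\<lambda>p q. \<chi> (\<kappa> p q)"
  have "cocycle ?Q M ?f"
    unfolding cocycle_def
    by (auto simp del: mult_FactGroup \<chi>_mult simp: \<kappa>_eq simp flip: \<chi>_mult)
  moreover have "symmetric_on_commuting ?Q ?f"
    unfolding symmetric_on_commuting_def
  proof (intro ballI impI)
    fix p q assume [simp]: "p \<in> carrier ?Q" "q \<in> carrier ?Q" and pq: "p \<otimes>\<^bsub>?Q\<^esub> q = q \<otimes>\<^bsub>?Q\<^esub> p"
    \<comment> \<open>For commuting \<open>p\<close> and \<open>q\<close> this quotient is exactly
      the commutator of the lifts \<open>s p\<close> and \<open>s q\<close>.\<close>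
    let ?k = "inv (\<kappa> q p) \<otimes> \<kappa> p q"
    have "inv (s p) \<otimes> inv (s q) \<otimes> s p \<otimes> s q = inv (s q \<otimes> s p) \<otimes> (s p \<otimes> s q)"
      by (simp add: inv_mult_group m_assoc)
    also have "\<dots> = inv (s (q \<otimes>\<^bsub>?Q\<^esub> p)) \<otimes> (?k \<otimes> s (q \<otimes>\<^bsub>?Q\<^esub> p))"
      by (simp add: s_mult pq inv_mult_group m_assoc del: mult_FactGroup)
    also have "\<dots> = ?k"
      using comm[of ?k "s (q \<otimes>\<^bsub>?Q\<^esub> p)"] by (simp del: mult_FactGroup flip: m_assoc)
    finally have "?k \<in> commutators G"
      using commutatorI[of "s p" G "s q"] by simp
    then have "\<chi> ?k = \<one>\<^bsub>M\<^esub>"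
      using triv by simp
    then have "\<chi> (\<kappa> q p) \<otimes>\<^bsub>M\<^esub> \<chi> ?k = \<chi> (\<kappa> q p)"
      by simp
    then have "\<chi> (\<kappa> q p \<otimes> ?k) = \<chi> (\<kappa> q p)"
      by (simp del: mult_FactGroup)
    then show "?f p q = ?f q p"
      by (simp flip: m_assoc del: \<chi>_mult)
  qed
  ultimately obtain g where g: "g \<in> carrier ?Q \<rightarrow> carrier M"
    and g_mult: "\<And>p q. p \<in> carrier ?Q \<Longrightarrow> q \<in> carrier ?Q \<Longrightarrow> ?f p q \<otimes>\<^bsub>M\<^esub> g (p \<otimes>\<^bsub>?Q\<^esub> q) = g p \<otimes>\<^bsub>M\<^esub> g q"
    using split unfolding commuting_symmetric_split_def cocycle_splits_def by metis
  have g_closed [simp]: "g q \<in> carrier M" if "q \<in> carrier ?Q" for q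
    using g that by auto
  have pQ [simp]: "C #> x \<in> carrier ?Q" if "x \<in> carrier G" for x
    using that by (auto simp: carrier_FactGroup)
  \<comment> \<open>Every \<open>x\<close> is an element \<open>c\<close> of \<open>C\<close> times
    the chosen representative of its coset \<open>q\<close>; the value is \<chi>(c) g(q), and the
    splitting equation for \<open>g\<close> absorbs the factor set.\<close>
  define \<psi> where "\<psi> x = \<chi> (x \<otimes> inv (s (C #> x))) \<otimes>\<^bsub>M\<^esub> g (C #> x)" for x
  have \<psi>: "\<psi> (c \<otimes> s q) = \<chi> c \<otimes>\<^bsub>M\<^esub> g q" if "c \<in> C" "q \<in> carrier ?Q" for c q
  proof -
    have "C #> (c \<otimes> s q) = C #> c #> s q"
      using that coset_mult_assoc[of C c "s q"] C.subset by simp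
    then have "C #> (c \<otimes> s q) = q"
      using that C.rcos_const[OF is_group] s by simp
    then show ?thesis
      using that by (simp add: \<psi>_def m_assoc)
  qed
  have decomp: "\<exists>c\<in>C. \<exists>q\<in>carrier ?Q. x = c \<otimes> s q" if x: "x \<in> carrier G" for x
  proof (intro bexI)
    show "x \<otimes> inv (s (C #> x)) \<in> C"
      using x s by (intro in_C) simp_all
    show "x = x \<otimes> inv (s (C #> x)) \<otimes> s (C #> x)"
      using x by (simp add: m_assoc)
  qed (use x in simp)
  have \<psi>_hom: "\<psi> \<in> hom G M"
  proof (rule homI)
    fix x assume "x \<in> carrier G"
    then show "\<psi> x \<in> carrier M"
      using decomp \<psi> by force
  next
    fix x y assume "x \<in> carrier G" "y \<in> carrier G"
    then obtain c d p q where x: "x = c \<otimes> s p" and y: "y = d \<otimes> s q"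
      and [simp]: "c \<in> C" "d \<in> C" "p \<in> carrier ?Q" "q \<in> carrier ?Q"
      using decomp by metis
    have "x \<otimes> y = c \<otimes> (s p \<otimes> d) \<otimes> s q"
      by (simp add: x y m_assoc)
    also have "\<dots> = c \<otimes> d \<otimes> (s p \<otimes> s q)"
      by (simp add: m_assoc flip: comm)
    also have "\<dots> = (c \<otimes> d \<otimes> \<kappa> p q) \<otimes> s (p \<otimes>\<^bsub>?Q\<^esub> q)"
      by (simp add: s_mult m_assoc del: mult_FactGroup)
    finally have "\<psi> (x \<otimes> y) = \<chi> (c \<otimes> d \<otimes> \<kappa> p q) \<otimes>\<^bsub>M\<^esub> g (p \<otimes>\<^bsub>?Q\<^esub> q)"
      by (simp add: \<psi> del: mult_FactGroup \<chi>_mult)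
    also have "\<dots> = \<chi> c \<otimes>\<^bsub>M\<^esub> \<chi> d \<otimes>\<^bsub>M\<^esub> (g p \<otimes>\<^bsub>M\<^esub> g q)"
      by (simp add: M.m_assoc g_mult del: mult_FactGroup)
    also have "\<dots> = \<psi> x \<otimes>\<^bsub>M\<^esub> \<psi> y"
      by (simp add: x y \<psi> M.m_ac)
    finally show "\<psi> (x \<otimes> y) = \<psi> x \<otimes>\<^bsub>M\<^esub> \<psi> y" .
  qed
  have "\<psi> c = \<chi> c" if "c \<in> C" for c
  proof -
    have pC: "C #> c = \<one>\<^bsub>?Q\<^esub>" "C #> \<one> = \<one>\<^bsub>?Q\<^esub>"
      using that C.rcos_const[OF is_group] by simp_all
    \<comment> \<open>The representative of the trivial coset may differ from \<one>. Evaluating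
      \<psi> at \<one> shows that the resulting correction cancels against the value of
      \<open>g\<close> at the unit.\<close>
    let ?u = "inv (s \<one>\<^bsub>?Q\<^esub>)"
    have u: "?u \<in> C"
      using in_C[of \<one> "s \<one>\<^bsub>?Q\<^esub>"] pC s[OF Q.one_closed] by simp
    have "\<chi> ?u \<otimes>\<^bsub>M\<^esub> g \<one>\<^bsub>?Q\<^esub> = \<psi> \<one>"
      using pC u by (simp add: \<psi>_def del: one_FactGroup)
    also have "\<dots> = \<one>\<^bsub>M\<^esub>"
      using hom_one[OF \<psi>_hom] is_group M.is_group by simp
    finally have "\<chi> c \<otimes>\<^bsub>M\<^esub> (\<chi> ?u \<otimes>\<^bsub>M\<^esub> g \<one>\<^bsub>?Q\<^esub>) = \<chi> c"
      using that by simp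
    then show ?thesis
      using that pC u by (simp add: \<psi>_def M.m_assoc del: one_FactGroup)
  qed
  moreover have "\<psi> c\<^sub>0 = \<one>\<^bsub>M\<^esub>"
    using hom_comm_group_derived[OF \<open>comm_group M\<close> \<psi>_hom] c\<^sub>0 by simp
  ultimately show "\<chi> c\<^sub>0 = \<one>\<^bsub>M\<^esub>"
    using c\<^sub>0 by simp
qed

text \<open>The inflation of \<open>f\<close> to \<open>A\<close> splits by some \<open>g\<close>,
  whose normalised restriction to \<open>C\<close> is a character \<chi>. Symmetry of
  \<open>f\<close> forces \<chi> to kill the commutators in \<open>C\<close>, hence by
  \<open>det\<close> all of \<open>C\<close> in the derived subgroup, so \<chi> extends to some
  \<psi> on \<open>A\<close>. Dividing \<open>g\<close> by \<psi> makes it constant on cosets, and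
  it then splits \<open>f\<close> itself.\<close>

lemma (in divisible_group) quotient_split_if_commutator_detecting:
  assumes "group A" and fin: "finite (carrier A)" and C: "subgroup C A" and central: "C \<subseteq> center A"
    and split: "commuting_symmetric_split A M" and det: "commutator_detecting A C M"
  shows "commuting_symmetric_split (A Mod C) M"
  unfolding commuting_symmetric_split_def
proof (intro allI impI)
  let ?Q = "A Mod C"
  fix f assume f: "cocycle ?Q M f" and sym: "symmetric_on_commuting ?Q f"
  interpret A: group A by fact
  let ?p = "\<lambda>x. C #>\<^bsub>A\<^esub> x"
  have CA [simp]: "c \<in> carrier A" if "c \<in> C" for c
    using subgroup.mem_carrier[OF C that] .
  have comm: "c \<otimes>\<^bsub>A\<^esub> x = x \<otimes>\<^bsub>A\<^esub> c" if "c \<in> C" "x \<in> carrier A" for c x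
    using that central by (auto simp: center_def)
  interpret C: normal C A
    using A.central_subgroup_normal[OF C central] .
  interpret f: group_cocycle ?Q M f
    using f C.factorgroup_is_group
    by (simp add: group_cocycle_def group_cocycle_axioms_def comm_group_axioms)
  interpret p: group_hom A ?Q ?p
    using C.r_coset_hom_Mod by unfold_locales
  have p_C: "?p c = \<one>\<^bsub>?Q\<^esub>" if "c \<in> C" for c
    using that C.rcos_const[OF A.is_group] by simp
  have p_closed [simp]: "?p x \<in> carrier ?Q" if "x \<in> carrier A" for x
    using p.hom_closed that .
  have "cocycle A M (\<lambda>x y. f (?p x) (?p y))"
    by (auto simp: cocycle_def f.cocycle_eq simp del: mult_FactGroup)
  moreover have "symmetric_on_commuting A (\<lambda>x y. f (?p x) (?p y))"
    unfolding symmetric_on_commuting_def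
  proof (intro ballI impI)
    fix x y assume xy: "x \<in> carrier A" "y \<in> carrier A" "x \<otimes>\<^bsub>A\<^esub> y = y \<otimes>\<^bsub>A\<^esub> x"
    then have "?p x \<otimes>\<^bsub>?Q\<^esub> ?p y = ?p y \<otimes>\<^bsub>?Q\<^esub> ?p x"
      using p.hom_mult[OF xy(1,2)] p.hom_mult[OF xy(2,1)] by argo
    then show "f (?p x) (?p y) = f (?p y) (?p x)"
      by (rule sym[unfolded symmetric_on_commuting_def, rule_format, OF p_closed[OF xy(1)] p_closed[OF xy(2)]])
  qed
  ultimately have "cocycle_splits A M (\<lambda>x y. f (?p x) (?p y))"
    using split by (simp add: commuting_symmetric_split_def)
  then obtain g where g: "g \<in> carrier A \<rightarrow> carrier M"
    and g_mult: "\<And>x y. x \<in> carrier A \<Longrightarrow> y \<in> carrier A \<Longrightarrow>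
      f (?p x) (?p y) \<otimes> g (x \<otimes>\<^bsub>A\<^esub> y) = g x \<otimes> g y"
    unfolding cocycle_splits_def by blast
  have g_closed [simp]: "g x \<in> carrier M" if "x \<in> carrier A" for x
    using g that by auto
  define k where "k = f \<one>\<^bsub>?Q\<^esub> \<one>\<^bsub>?Q\<^esub>"
  have k [simp]: "k \<in> carrier M"
    unfolding k_def using f.closed[OF f.G.one_closed f.G.one_closed] .
  \<comment> \<open>The splitting equation at the unit gives \<open>k\<close> as the value of
    \<open>g\<close> there, so dividing by \<open>k\<close> yields a map that fixes the
    unit.\<close>
  define \<chi> where "\<chi> c = inv k \<otimes> g c" for c
  have \<chi>_closed [simp]: "\<chi> c \<in> carrier M" if "c \<in> C" for c
    using that by (simp add: \<chi>_def)
  have g_C: "g (c \<otimes>\<^bsub>A\<^esub> x) = \<chi> c \<otimes> g x" if [simp]: "c \<in> C" "x \<in> carrier A" for c x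
  proof -
    have "k \<otimes> g (c \<otimes>\<^bsub>A\<^esub> x) = g c \<otimes> g x"
      using g_mult[of c x] f.one_left[of "?p x"] by (simp add: p_C k_def del: one_FactGroup)
    then have "g (c \<otimes>\<^bsub>A\<^esub> x) = inv k \<otimes> (g c \<otimes> g x)"
      by (simp add: inv_solve_left)
    then show ?thesis
      by (simp add: \<chi>_def m_assoc)
  qed
  have \<chi>_hom: "\<chi> \<in> hom (A\<lparr>carrier := C\<rparr>) M"
  proof (rule homI)
    fix c d assume "c \<in> carrier (A\<lparr>carrier := C\<rparr>)" "d \<in> carrier (A\<lparr>carrier := C\<rparr>)"
    then have [simp]: "c \<in> C" "d \<in> C" by auto
    have "\<chi> (c \<otimes>\<^bsub>A\<^esub> d) = inv k \<otimes> (\<chi> c \<otimes> g d)"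
      by (simp add: \<chi>_def[of "c \<otimes>\<^bsub>A\<^esub> d"] g_C)
    also have "\<dots> = \<chi> c \<otimes> \<chi> d"
      by (simp add: \<chi>_def[of d] m_lcomm)
    finally show "\<chi> (c \<otimes>\<^bsub>A\<lparr>carrier := C\<rparr>\<^esub> d) = \<chi> c \<otimes> \<chi> d"
      by simp
  qed simp
  have "\<chi> c = \<one>" if c: "c \<in> C \<inter> commutators A" for c
  proof -
    obtain x y where [simp]: "x \<in> carrier A" "y \<in> carrier A"
      and c_eq: "c = inv\<^bsub>A\<^esub> x \<otimes>\<^bsub>A\<^esub> inv\<^bsub>A\<^esub> y \<otimes>\<^bsub>A\<^esub> x \<otimes>\<^bsub>A\<^esub> y"
      using c by (auto simp: commutators_def)
    have "c = inv\<^bsub>A\<^esub> (y \<otimes>\<^bsub>A\<^esub> x) \<otimes>\<^bsub>A\<^esub> (x \<otimes>\<^bsub>A\<^esub> y)"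
      by (simp add: c_eq A.inv_mult_group A.m_assoc)
    then have "x \<otimes>\<^bsub>A\<^esub> y = (y \<otimes>\<^bsub>A\<^esub> x) \<otimes>\<^bsub>A\<^esub> c"
      by (simp flip: A.m_assoc)
    then have xy: "x \<otimes>\<^bsub>A\<^esub> y = c \<otimes>\<^bsub>A\<^esub> (y \<otimes>\<^bsub>A\<^esub> x)"
      using c comm[of c "y \<otimes>\<^bsub>A\<^esub> x"] by simp
    \<comment> \<open>Since \<open>c\<close> vanishes in the quotient, the images of
      \<open>x\<close> and \<open>y\<close> commute even if \<open>x\<close> and \<open>y\<close> do
      not; this is where symmetry of \<open>f\<close> on the quotient is used.\<close>
    have "?p (x \<otimes>\<^bsub>A\<^esub> y) = ?p c \<otimes>\<^bsub>?Q\<^esub> ?p (y \<otimes>\<^bsub>A\<^esub> x)"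
      unfolding xy using c by (intro p.hom_mult) auto
    also have "\<dots> = ?p (y \<otimes>\<^bsub>A\<^esub> x)"
      using c p_C[of c] f.G.l_one[of "?p (y \<otimes>\<^bsub>A\<^esub> x)"] by (simp del: mult_FactGroup one_FactGroup)
    finally have "?p x \<otimes>\<^bsub>?Q\<^esub> ?p y = ?p y \<otimes>\<^bsub>?Q\<^esub> ?p x"
      using p.hom_mult[of x y] p.hom_mult[of y x] \<open>x \<in> carrier A\<close> \<open>y \<in> carrier A\<close> by argo
    then have "f (?p x) (?p y) = f (?p y) (?p x)"
      by (rule sym[unfolded symmetric_on_commuting_def, rule_format, OF p_closed p_closed, rotated 2]) simp_all
    then have "f (?p y) (?p x) \<otimes> g (x \<otimes>\<^bsub>A\<^esub> y) = f (?p y) (?p x) \<otimes> g (y \<otimes>\<^bsub>A\<^esub> x)"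
      using g_mult[of x y] g_mult[of y x] by (simp add: m_comm)
    then have "g (x \<otimes>\<^bsub>A\<^esub> y) = g (y \<otimes>\<^bsub>A\<^esub> x)"
      by simp
    then have "\<chi> c \<otimes> g (y \<otimes>\<^bsub>A\<^esub> x) = g (y \<otimes>\<^bsub>A\<^esub> x)"
      using c g_C[of c "y \<otimes>\<^bsub>A\<^esub> x"] by (simp add: xy)
    then show ?thesis
      using c by simp
  qed
  then have "\<chi> c = \<one>" if "c \<in> C \<inter> derived A (carrier A)" for c
    using det \<chi>_hom that unfolding commutator_detecting_def by blast
  then obtain \<psi> where \<psi>: "\<psi> \<in> hom A M" and \<psi>_C: "\<And>c. c \<in> C \<Longrightarrow> \<psi> c = \<chi> c"
    using hom_extension[OF A.is_group fin C \<chi>_hom] by metis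
  have \<psi>_closed [simp]: "\<psi> x \<in> carrier M" if "x \<in> carrier A" for x
    using \<psi> that by (auto simp: hom_def)
  have \<psi>_mult: "\<psi> (x \<otimes>\<^bsub>A\<^esub> y) = \<psi> x \<otimes> \<psi> y" if "x \<in> carrier A" "y \<in> carrier A" for x y
    using \<psi> that by (auto simp: hom_def)
  \<comment> \<open>Multiplying \<open>x\<close> by \<open>c\<close> in \<open>C\<close> multiplies
    both \<open>g x\<close> and \<open>\<psi> x\<close> by \<chi>(c), so the quotient depends only
    on the coset.\<close>
  define g' where "g' x = g x \<otimes> inv (\<psi> x)" for x
  have g'_C: "g' (c \<otimes>\<^bsub>A\<^esub> x) = g' x" if [simp]: "c \<in> C" "x \<in> carrier A" for c x
  proof -
    have "\<chi> c \<otimes> (inv (\<chi> c) \<otimes> inv (\<psi> x)) = inv (\<psi> x)"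
      by (simp flip: m_assoc)
    then show ?thesis
      by (simp add: g'_def g_C \<psi>_mult \<psi>_C inv_mult m_comm[of "\<chi> c" "g x"] m_assoc)
  qed
  have "g' x = g' y" if "x \<in> carrier A" "y \<in> carrier A" "?p x = ?p y" for x y
  proof -
    have "x \<in> ?p y"
      using A.rcos_self[OF that(1) C] that(3) by simp
    then show ?thesis
      using that(2) g'_C by (auto simp: r_coset_def)
  qed
  then obtain \<gamma> where \<gamma>: "\<And>x. x \<in> carrier A \<Longrightarrow> g' x = \<gamma> (?p x)"
    using function_factors_left_gen[of "\<lambda>x. x \<in> carrier A" ?p g'] by blast
  have "\<gamma> \<in> carrier ?Q \<rightarrow> carrier M"
    by (auto simp: carrier_FactGroup g'_def simp flip: \<gamma>)
  moreover have "f u v \<otimes> \<gamma> (u \<otimes>\<^bsub>?Q\<^esub> v) = \<gamma> u \<otimes> \<gamma> v" if uv_in: "u \<in> carrier ?Q" "v \<in> carrier ?Q" for u v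
  proof -
    obtain x y where uv: "u = ?p x" "v = ?p y" and [simp]: "x \<in> carrier A" "y \<in> carrier A"
      using uv_in unfolding carrier_FactGroup by blast
    have "f u v \<otimes> \<gamma> (u \<otimes>\<^bsub>?Q\<^esub> v) = f u v \<otimes> g' (x \<otimes>\<^bsub>A\<^esub> y)"
      by (simp add: uv \<gamma> del: mult_FactGroup flip: p.hom_mult)
    also have "\<dots> = (f u v \<otimes> g (x \<otimes>\<^bsub>A\<^esub> y)) \<otimes> inv (\<psi> x \<otimes> \<psi> y)"
      by (simp add: uv g'_def \<psi>_mult m_assoc)
    also have "\<dots> = g x \<otimes> g y \<otimes> inv (\<psi> x \<otimes> \<psi> y)"
      by (simp add: uv g_mult)
    also have "\<dots> = g' x \<otimes> g' y"
      by (simp add: g'_def inv_mult m_ac)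
    finally show ?thesis
      by (simp add: uv \<gamma>)
  qed
  ultimately show "cocycle_splits ?Q M f"
    unfolding cocycle_splits_def by blast
qed

section \<open>The Bogomolov multiplier\<close>

lemma (in group) commuting_pair_in_abelian_subgroup:
  assumes "x \<in> carrier G" "y \<in> carrier G" "x \<otimes> y = y \<otimes> x"
  obtains A where "subgroup A G" "comm_group (G\<lparr>carrier := A\<rparr>)" "x \<in> A" "y \<in> A"
proof
  \<comment> \<open>the center of the centralizer of \<open>{x, y}\<close>\<close>
  let ?Z = "{z \<in> carrier G. z \<otimes> x = x \<otimes> z \<and> z \<otimes> y = y \<otimes> z}"
  let ?A = "{a \<in> carrier G. \<forall>z\<in>?Z. a \<otimes> z = z \<otimes> a}"
  show A: "subgroup ?A G"
  proof (rule subgroupI)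
    fix a assume a: "a \<in> ?A"
    have "inv a \<otimes> z = z \<otimes> inv a" if "z \<in> ?Z" for z
    proof -
      have [simp]: "a \<in> carrier G" "z \<in> carrier G" and az: "a \<otimes> z = z \<otimes> a"
        using a that by auto
      have "inv a \<otimes> (z \<otimes> a) \<otimes> inv a = z \<otimes> inv a"
        by (simp add: m_assoc flip: az) (simp flip: m_assoc)
      then show ?thesis
        by (simp add: m_assoc)
    qed
    then show "inv a \<in> ?A"
      using a by blast
    fix b assume b: "b \<in> ?A"
    have "a \<otimes> b \<otimes> z = z \<otimes> (a \<otimes> b)" if "z \<in> ?Z" for z
    proof -
      have [simp]: "a \<in> carrier G" "b \<in> carrier G" "z \<in> carrier G"
        and az: "a \<otimes> z = z \<otimes> a" and bz: "b \<otimes> z = z \<otimes> b"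
        using a b that by auto
      have "a \<otimes> b \<otimes> z = a \<otimes> z \<otimes> b"
        by (simp add: m_assoc bz)
      then show ?thesis
        by (simp add: az m_assoc)
    qed
    then show "a \<otimes> b \<in> ?A"
      using a b by blast
  qed auto
  have xy: "x \<in> ?Z" "y \<in> ?Z"
    using assms by auto
  show "comm_group (G\<lparr>carrier := ?A\<rparr>)"
  proof (rule group.group_comm_groupI)
    show "group (G\<lparr>carrier := ?A\<rparr>)"
      using subgroup_imp_group[OF A] .
    fix a b assume "a \<in> carrier (G\<lparr>carrier := ?A\<rparr>)" "b \<in> carrier (G\<lparr>carrier := ?A\<rparr>)"
    then have a: "a \<in> ?A" and b: "b \<in> ?A" by auto
    \<comment> \<open>Since \<open>x\<close> and \<open>y\<close> themselves lie in
      \<open>?Z\<close>, an element commuting with all of \<open>?Z\<close> commutes with both and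
      so lies in \<open>?Z\<close>; hence \<open>a\<close> commutes with it.\<close>
    then have "b \<in> ?Z"
      using xy by blast
    then show "a \<otimes>\<^bsub>G\<lparr>carrier := ?A\<rparr>\<^esub> b = b \<otimes>\<^bsub>G\<lparr>carrier := ?A\<rparr>\<^esub> a"
      using a by simp
  qed
  show "x \<in> ?A" "y \<in> ?A"
    using assms by auto
qed

section \<open>From cohomology classes to splitting of cocycles\<close>

lemma (in comm_group) coboundaries2_iff_cocycle_splits:
  assumes "group A" and f: "f \<in> carrier (cocycles2 A G)"
  shows "f \<in> coboundaries2 A G \<longleftrightarrow> cocycle_splits A G (\<lambda>x y. f (x, y))"
proof
  interpret A: group A by fact
  assume "f \<in> coboundaries2 A G"
  then obtain g where g: "g \<in> carrier A \<rightarrow>\<^sub>E carrier G" and f_eq: "f = coboundary A G g"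
    by (auto simp: coboundaries2_def cochains1_def)
  have [simp]: "g x \<in> carrier G" if "x \<in> carrier A" for x
    using g that by auto
  have "f (x, y) \<otimes> g (x \<otimes>\<^bsub>A\<^esub> y) = g x \<otimes> g y" if "x \<in> carrier A" "y \<in> carrier A" for x y
  proof -
    have "f (x, y) \<otimes> g (x \<otimes>\<^bsub>A\<^esub> y) = g x \<otimes> g y \<otimes> (inv (g (x \<otimes>\<^bsub>A\<^esub> y)) \<otimes> g (x \<otimes>\<^bsub>A\<^esub> y))"
      using that by (simp add: f_eq coboundary_def m_ac del: l_inv)
    then show ?thesis
      using that by simp
  qed
  then show "cocycle_splits A G (\<lambda>x y. f (x, y))"
    unfolding cocycle_splits_def by (intro bexI[of _ g]) (use g in auto)
next
  interpret A: group A by fact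
  assume "cocycle_splits A G (\<lambda>x y. f (x, y))"
  then obtain g where g: "g \<in> carrier A \<rightarrow> carrier G"
    and fg: "\<And>x y. x \<in> carrier A \<Longrightarrow> y \<in> carrier A \<Longrightarrow> f (x, y) \<otimes> g (x \<otimes>\<^bsub>A\<^esub> y) = g x \<otimes> g y"
    unfolding cocycle_splits_def by blast
  have [simp]: "g x \<in> carrier G" if "x \<in> carrier A" for x
    using g that by auto
  have fE: "f \<in> carrier A \<times> carrier A \<rightarrow>\<^sub>E carrier G"
    using f by (simp add: mem_cocycles2)
  then have [simp]: "f (x, y) \<in> carrier G" if "x \<in> carrier A" "y \<in> carrier A" for x y
    using that by auto
  have "f (x, y) = g y \<otimes> inv (g (x \<otimes>\<^bsub>A\<^esub> y)) \<otimes> g x" if "x \<in> carrier A" "y \<in> carrier A" for x y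
  proof -
    have "f (x, y) = g x \<otimes> g y \<otimes> inv (g (x \<otimes>\<^bsub>A\<^esub> y))"
      using that fg by (simp add: inv_solve_right)
    then show ?thesis
      using that by (simp add: m_ac)
  qed
  then have "f = coboundary A G (restrict g (carrier A))"
    using fE by (auto simp: coboundary_def fun_eq_iff PiE_def extensional_def)
  moreover have "restrict g (carrier A) \<in> carrier (cochains1 A G)"
    by (simp add: cochains1_def)
  ultimately show "f \<in> coboundaries2 A G"
    unfolding coboundaries2_def by blast
qed

text \<open>A coboundary is symmetric wherever the arguments commute, because the coefficients are
  commutative.\<close>

lemma (in comm_group) cocycle_splits_imp_symmetric_on_commuting:
  assumes "group A" and f: "cocycle A G f" and "cocycle_splits A G f"
  shows "symmetric_on_commuting A f"
  unfolding symmetric_on_commuting_def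
proof (intro ballI impI)
  interpret A: group A by fact
  obtain g where g: "g \<in> carrier A \<rightarrow> carrier G"
    and fg: "\<And>x y. x \<in> carrier A \<Longrightarrow> y \<in> carrier A \<Longrightarrow> f x y \<otimes> g (x \<otimes>\<^bsub>A\<^esub> y) = g x \<otimes> g y"
    using assms(3) unfolding cocycle_splits_def by blast
  fix x y assume xy: "x \<in> carrier A" "y \<in> carrier A" "x \<otimes>\<^bsub>A\<^esub> y = y \<otimes>\<^bsub>A\<^esub> x"
  have closed: "g x \<in> carrier G" "g y \<in> carrier G" "g (y \<otimes>\<^bsub>A\<^esub> x) \<in> carrier G"
      "f x y \<in> carrier G" "f y x \<in> carrier G"
    using g f xy(1,2) by (auto simp: cocycle_def)
  have "f x y \<otimes> g (y \<otimes>\<^bsub>A\<^esub> x) = f y x \<otimes> g (y \<otimes>\<^bsub>A\<^esub> x)"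
    using fg[OF xy(1,2)] fg[OF xy(2,1)] closed by (simp add: xy(3) m_comm)
  then show "f x y = f y x"
    using closed by simp
qed

text \<open>The restricted class is trivial iff the restricted cocycle splits. On a finite abelian
  group this is equivalent to symmetry, by the previous lemma and
  \<open>symmetric_cocycle_splits\<close>.\<close>

lemma (in divisible_group) mem_kernel_H2_res_iff:
  assumes "group Q" and "finite (carrier Q)" and A: "subgroup A Q" and "comm_group (Q\<lparr>carrier := A\<rparr>)"
    and f: "f \<in> carrier (cocycles2 Q M)"
  shows "coboundaries2 Q M #>\<^bsub>cocycles2 Q M\<^esub> f
      \<in> kernel (H2 Q M) (H2 (Q\<lparr>carrier := A\<rparr>) M) (H2_res Q M A)
    \<longleftrightarrow> (\<forall>x\<in>A. \<forall>y\<in>A. f (x, y) = f (y, x))"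
proof -
  let ?A = "Q\<lparr>carrier := A\<rparr>"
  interpret A: comm_group ?A by fact
  interpret ZA: comm_group "cocycles2 ?A M"
    using comm_group_cocycles2[OF A.is_group comm_group_axioms] .
  have AQ: "x \<in> carrier Q" if "x \<in> A" for x
    using subgroup.mem_carrier[OF A that] .
  have fA: "restrict f (A \<times> A) \<in> carrier (cocycles2 ?A M)"
    using f AQ subgroup.m_closed[OF A] by (auto simp: mem_cocycles2 PiE_iff)
  then have cA: "cocycle ?A M (\<lambda>x y. restrict f (A \<times> A) (x, y))"
    using subgroup.m_closed[OF A] by (simp add: mem_cocycles2 cocycle_def PiE_iff)
  have "coboundaries2 Q M #>\<^bsub>cocycles2 Q M\<^esub> f
      \<in> kernel (H2 Q M) (H2 ?A M) (H2_res Q M A)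
    \<longleftrightarrow> coboundaries2 ?A M #>\<^bsub>cocycles2 ?A M\<^esub> restrict f (A \<times> A) = coboundaries2 ?A M"
    using f by (simp add: kernel_def H2_def carrier_FactGroup
        H2_res_coset[OF assms(1) comm_group_axioms A])
  also have "\<dots> \<longleftrightarrow> restrict f (A \<times> A) \<in> coboundaries2 ?A M"
    using ZA.coset_join1[OF _ fA] ZA.coset_join2[OF fA]
      coboundaries2_normal[OF A.is_group comm_group_axioms, THEN normal_imp_subgroup]
      subgroup.subset by metis
  also have "\<dots> \<longleftrightarrow> cocycle_splits ?A M (\<lambda>x y. restrict f (A \<times> A) (x, y))"
    using coboundaries2_iff_cocycle_splits[OF A.is_group fA] .
  also have "\<dots> \<longleftrightarrow> symmetric_on_commuting ?A (\<lambda>x y. restrict f (A \<times> A) (x, y))"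
    using cocycle_splits_imp_symmetric_on_commuting[OF A.is_group cA]
      symmetric_cocycle_splits[OF A.comm_group_axioms _ cA] assms(2) AQ
      finite_subset[of A "carrier Q"] by auto
  also have "\<dots> \<longleftrightarrow> (\<forall>x\<in>A. \<forall>y\<in>A. f (x, y) = f (y, x))"
    using A.m_comm by (auto simp: symmetric_on_commuting_def)
  finally show ?thesis .
qed

lemma divisible_group_rat_mod_int: "divisible_group rat_mod_int"
proof -
  let ?Q = "\<lparr>carrier = UNIV, monoid.mult = (+), one = 0\<rparr> :: rat monoid"
  interpret Q: comm_group ?Q
  proof (rule comm_groupI)
    show "\<exists>y\<in>carrier ?Q. y \<otimes>\<^bsub>?Q\<^esub> x = \<one>\<^bsub>?Q\<^esub>" for x
      by (simp add: exI[of _ "- x"])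
  qed simp_all
  have inv: "inv\<^bsub>?Q\<^esub> x = - x" for x
    by (rule Q.inv_equality) auto
  have "subgroup \<int> ?Q"
    by (rule Q.subgroupI) (auto simp: inv)
  then interpret Z: normal \<int> ?Q
    by (rule Q.subgroup_imp_normal)
  have pow: "q [^]\<^bsub>?Q\<^esub> n = of_nat n * q" for q and n :: nat
    by (induction n) (simp_all add: algebra_simps)
  interpret M: comm_group rat_mod_int
    by (rule comm_group_rat_mod_int)
  show ?thesis
  proof
    fix d and n :: nat assume "d \<in> carrier rat_mod_int" "0 < n"
    then obtain q where d: "d = \<int> #>\<^bsub>?Q\<^esub> q"
      by (auto simp: rat_mod_int_def carrier_FactGroup)
    have "(\<int> #>\<^bsub>?Q\<^esub> (q / of_nat n)) [^]\<^bsub>rat_mod_int\<^esub> n = d"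
      using Z.FactGroup_pow[of "q / of_nat n" n] \<open>0 < n\<close> by (simp add: rat_mod_int_def pow d)
    then show "\<exists>e\<in>carrier rat_mod_int. e [^]\<^bsub>rat_mod_int\<^esub> n = d"
      by (intro bexI[of _ "\<int> #>\<^bsub>?Q\<^esub> (q / of_nat n)"]) (auto simp: rat_mod_int_def carrier_FactGroup)
  qed
qed

text \<open>Two elements lie in a common abelian subgroup exactly when they commute, so the kernel
  conditions for all abelian subgroups together amount to symmetry on commuting pairs.\<close>

lemma trivial_bogomolov_multiplier_iff:
  assumes "group Q" and fin: "finite (carrier Q)"
  shows "trivial_bogomolov_multiplier Q \<longleftrightarrow> commuting_symmetric_split Q rat_mod_int"
proof -
  interpret M: divisible_group rat_mod_int by (rule divisible_group_rat_mod_int)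
  interpret Q: group Q by fact
  let ?M = rat_mod_int
  let ?Z = "cocycles2 Q ?M" and ?B = "coboundaries2 Q ?M"
  interpret Z: comm_group ?Z
    using comm_group_cocycles2[OF Q.is_group M.comm_group_axioms] .
  have B: "subgroup ?B ?Z"
    using coboundaries2_normal[OF Q.is_group M.comm_group_axioms] by (rule normal_imp_subgroup)
  let ?sym = "\<lambda>f. symmetric_on_commuting Q (\<lambda>x y. f (x, y))"
  have mem: "?B #>\<^bsub>?Z\<^esub> f \<in> bogomolov_multiplier Q \<longleftrightarrow> ?sym f" if f: "f \<in> carrier ?Z" for f
  proof -
    have "?B #>\<^bsub>?Z\<^esub> f \<in> bogomolov_multiplier Q \<longleftrightarrow>
        (\<forall>A. subgroup A Q \<and> comm_group (Q\<lparr>carrier := A\<rparr>) \<longrightarrow> (\<forall>x\<in>A. \<forall>y\<in>A. f (x, y) = f (y, x)))"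
      using M.mem_kernel_H2_res_iff[OF Q.is_group fin _ _ f] by (auto simp: bogomolov_multiplier_def)
    also have "\<dots> \<longleftrightarrow> ?sym f"
    proof
      assume *: "\<forall>A. subgroup A Q \<and> comm_group (Q\<lparr>carrier := A\<rparr>) \<longrightarrow> (\<forall>x\<in>A. \<forall>y\<in>A. f (x, y) = f (y, x))"
      show "?sym f"
        unfolding symmetric_on_commuting_def
        using * Q.commuting_pair_in_abelian_subgroup by metis
    next
      assume *: "?sym f"
      show "\<forall>A. subgroup A Q \<and> comm_group (Q\<lparr>carrier := A\<rparr>) \<longrightarrow> (\<forall>x\<in>A. \<forall>y\<in>A. f (x, y) = f (y, x))"
      proof (intro allI impI ballI, elim conjE)
        fix A x y assume A: "subgroup A Q" "comm_group (Q\<lparr>carrier := A\<rparr>)" and xy: "x \<in> A" "y \<in> A"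
        then have "x \<otimes>\<^bsub>Q\<^esub> y = y \<otimes>\<^bsub>Q\<^esub> x"
          using comm_groupE(4)[OF A(2), of x y] by simp
        then show "f (x, y) = f (y, x)"
          using * xy subgroup.mem_carrier[OF A(1)] by (simp add: symmetric_on_commuting_def)
      qed
    qed
    finally show ?thesis .
  qed
  have carrier: "\<exists>f\<in>carrier ?Z. c = ?B #>\<^bsub>?Z\<^esub> f" if "c \<in> bogomolov_multiplier Q" for c
  proof -
    \<comment> \<open>The trivial subgroup takes part in the intersection, which is therefore
      contained in the carrier of \<open>H2\<close>.\<close>
    have "comm_group (Q\<lparr>carrier := {\<one>\<^bsub>Q\<^esub>}\<rparr>)"
      using Q.subgroup_imp_group[OF Q.triv_subgroup] by (rule group.group_comm_groupI) simp
    then have "c \<in> carrier (H2 Q ?M)"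
      using that Q.triv_subgroup by (auto simp: bogomolov_multiplier_def kernel_def)
    then show ?thesis
      by (auto simp: H2_def carrier_FactGroup)
  qed
  have coset_B: "?B #>\<^bsub>?Z\<^esub> f = ?B \<longleftrightarrow> cocycle_splits Q ?M (\<lambda>x y. f (x, y))" if f: "f \<in> carrier ?Z" for f
    using Z.coset_join1[OF _ f B] Z.coset_join2[OF f B] subgroup.subset[OF B]
      M.coboundaries2_iff_cocycle_splits[OF Q.is_group f] by metis
  have "?B #>\<^bsub>?Z\<^esub> \<one>\<^bsub>?Z\<^esub> = ?B"
    using Z.coset_mult_one subgroup.subset[OF B] by blast
  moreover have "?sym \<one>\<^bsub>?Z\<^esub>"
    by (simp add: symmetric_on_commuting_def)
  ultimately have "?B \<in> bogomolov_multiplier Q"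
    using mem[OF Z.one_closed] by simp
  then have "trivial_bogomolov_multiplier Q \<longleftrightarrow> (\<forall>c\<in>bogomolov_multiplier Q. c = ?B)"
    by (auto simp: trivial_bogomolov_multiplier_def H2_def)
  also have "\<dots> \<longleftrightarrow> (\<forall>f\<in>carrier ?Z. ?sym f \<longrightarrow> cocycle_splits Q ?M (\<lambda>x y. f (x, y)))"
    using carrier mem coset_B by metis
  also have "\<dots> \<longleftrightarrow> commuting_symmetric_split Q ?M"
  proof
    assume *: "\<forall>f\<in>carrier ?Z. ?sym f \<longrightarrow> cocycle_splits Q ?M (\<lambda>x y. f (x, y))"
    show "commuting_symmetric_split Q ?M"
      unfolding commuting_symmetric_split_def
    proof (intro allI impI)
      fix f assume f: "cocycle Q ?M f" and sym: "symmetric_on_commuting Q f"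
      \<comment> \<open>Restriction makes \<open>f\<close> extensional, as \<open>cocycles2\<close>
        requires, and affects neither symmetry nor splitting.\<close>
      let ?f = "\<lambda>(x, y)\<in>carrier Q \<times> carrier Q. f x y"
      have "?f \<in> carrier ?Z"
        using f by (auto simp: mem_cocycles2 cocycle_def)
      moreover have "?sym ?f"
        using sym by (simp add: symmetric_on_commuting_def)
      ultimately have "cocycle_splits Q ?M (\<lambda>x y. ?f (x, y))"
        using * by blast
      then show "cocycle_splits Q ?M f"
        by (simp add: cocycle_splits_def)
    qed
  next
    assume *: "commuting_symmetric_split Q ?M"
    have "cocycle Q ?M (\<lambda>x y. f (x, y))" if "f \<in> carrier ?Z" for f
      using that by (auto simp: mem_cocycles2 cocycle_def)
    with * show "\<forall>f\<in>carrier ?Z. ?sym f \<longrightarrow> cocycle_splits Q ?M (\<lambda>x y. f (x, y))"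
      unfolding commuting_symmetric_split_def by simp
  qed
  finally show ?thesis .
qed

lemma trivial_bogomolov_multiplier_quotient_iff:
  assumes A: "group A" and fin: "finite (carrier A)" and C: "subgroup C A" and central: "C \<subseteq> center A"
    and split: "commuting_symmetric_split A rat_mod_int"
  shows "trivial_bogomolov_multiplier (A Mod C) \<longleftrightarrow> commutator_detecting A C rat_mod_int"
proof -
  interpret A: group A by (rule A)
  interpret M: divisible_group rat_mod_int by (rule divisible_group_rat_mod_int)
  have "group (A Mod C)"
    using A.central_subgroup_normal[OF C central] by (rule normal.factorgroup_is_group)
  moreover have "finite (carrier (A Mod C))"
    using fin by (simp add: carrier_FactGroup)
  ultimately show ?thesis
    using trivial_bogomolov_multiplier_iff
      A.commutator_detecting_if_quotient_split[OF C central M.comm_group_axioms]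
      M.quotient_split_if_commutator_detecting[OF A fin C central split] by blast
qed

section \<open>Central products\<close>

lemma (in group_hom) hom_commutators: "c \<in> commutators G \<Longrightarrow> h c \<in> commutators H"
  by (auto simp: commutators_def)
    (metis G.inv_closed hom_closed hom_inv)

text \<open>The inverse of [x, y] is [y, x].\<close>

lemma (in group) inv_commutators:
  assumes "c \<in> commutators G"
  shows "inv c \<in> commutators G"
proof -
  obtain x y where "x \<in> carrier G" "y \<in> carrier G" "c = inv x \<otimes> inv y \<otimes> x \<otimes> y"
    using assms by (auto simp: commutators_def)
  then have "inv c = inv y \<otimes> inv x \<otimes> y \<otimes> x"
    by (simp add: inv_mult_group m_assoc)
  then show ?thesis
    using commutatorI \<open>x \<in> carrier G\<close> \<open>y \<in> carrier G\<close> by simp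
qed

lemma commutators_DirProd:
  assumes "group H" "group N" "a \<in> commutators H" "b \<in> commutators N"
  shows "(a, b) \<in> commutators (H \<times>\<times> N)"
proof -
  obtain x y where xy: "x \<in> carrier H" "y \<in> carrier H"
    "a = inv\<^bsub>H\<^esub> x \<otimes>\<^bsub>H\<^esub> inv\<^bsub>H\<^esub> y \<otimes>\<^bsub>H\<^esub> x \<otimes>\<^bsub>H\<^esub> y"
    using assms(3) by (auto simp: commutators_def)
  obtain u v where uv: "u \<in> carrier N" "v \<in> carrier N"
    "b = inv\<^bsub>N\<^esub> u \<otimes>\<^bsub>N\<^esub> inv\<^bsub>N\<^esub> v \<otimes>\<^bsub>N\<^esub> u \<otimes>\<^bsub>N\<^esub> v"
    using assms(4) by (auto simp: commutators_def)
  show ?thesis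
    using commutatorI[of "(x, u)" "H \<times>\<times> N" "(y, v)"] xy uv assms(1,2) by simp
qed

text \<open>Write (a, b) as the product of (a, \<one>) and (\<one>, b), the images of derived
  elements under the two embeddings.\<close>

lemma derived_DirProd:
  assumes "group H" "group N" "a \<in> derived H (carrier H)" "b \<in> derived N (carrier N)"
  shows "(a, b) \<in> derived (H \<times>\<times> N) (carrier (H \<times>\<times> N))"
proof -
  interpret H: group H by fact
  interpret N: group N by fact
  interpret HN: group "H \<times>\<times> N" using DirProd_group assms(1,2) .
  interpret i: group_hom H "H \<times>\<times> N" "\<lambda>h. (h, \<one>\<^bsub>N\<^esub>)"
    by unfold_locales (auto intro: homI)
  interpret j: group_hom N "H \<times>\<times> N" "\<lambda>n. (\<one>\<^bsub>H\<^esub>, n)"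
    by unfold_locales (auto intro: homI)
  have "a \<in> carrier H" "b \<in> carrier N"
    using assms(3,4) H.derived_in_carrier N.derived_in_carrier by blast+
  then show ?thesis
    using subgroup.m_closed[OF HN.derived_is_subgroup[OF order.refl]
        i.hom_derived[OF assms(3)] j.hom_derived[OF assms(4)]] by simp
qed

text \<open>The subgroup factored out in \<open>central_product\<close>; the first projection
  identifies it with \<open>C\<close>.\<close>

definition antidiagonal :: "('b, 'n) monoid_scheme \<Rightarrow> 'a set \<Rightarrow> ('a \<Rightarrow> 'b) \<Rightarrow> ('a \<times> 'b) set"
  where "antidiagonal N C \<xi> = {(a, inv\<^bsub>N\<^esub> (\<xi> a)) | a. a \<in> C}"

section \<open>The central subgroup of a direct product defined by a homomorphism\<close>

locale central_amalgamation = H: group H + N: group N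
  for H :: "('a, 'm) monoid_scheme" and N :: "('b, 'n) monoid_scheme"
    and C :: "'a set" and \<xi> :: "'a \<Rightarrow> 'b" +
  assumes C: "subgroup C H" and C_central: "C \<subseteq> center H"
    and \<xi>_hom: "\<xi> \<in> hom (H\<lparr>carrier := C\<rparr>) N" and \<xi>_central: "\<xi> ` C \<subseteq> center N"
begin

sublocale HN: group "H \<times>\<times> N"
  using DirProd_group H.is_group N.is_group .

sublocale \<xi>: group_hom "H\<lparr>carrier := C\<rparr>" N \<xi>
  by (intro group_hom.intro group_hom_axioms.intro H.subgroup_imp_group[OF C] N.is_group \<xi>_hom)

abbreviation Z :: "('a \<times> 'b) set"
  where "Z \<equiv> antidiagonal N C \<xi>"

lemma C_carrier [simp]: "a \<in> C \<Longrightarrow> a \<in> carrier H"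
  using subgroup.mem_carrier[OF C] .

lemma \<xi>_carrier [simp]: "a \<in> C \<Longrightarrow> \<xi> a \<in> carrier N"
  using \<xi>.hom_closed[of a] by simp

lemma \<xi>_mult: "\<lbrakk>a \<in> C; b \<in> C\<rbrakk> \<Longrightarrow> \<xi> (a \<otimes>\<^bsub>H\<^esub> b) = \<xi> a \<otimes>\<^bsub>N\<^esub> \<xi> b"
  using \<xi>.hom_mult[of a b] by simp

lemma \<xi>_inv: "a \<in> C \<Longrightarrow> \<xi> (inv\<^bsub>H\<^esub> a) = inv\<^bsub>N\<^esub> (\<xi> a)"
  using \<xi>.hom_inv[of a] H.m_inv_consistent[OF C, of a] by simp

lemma inv_\<xi>_central:
  assumes a: "a \<in> C" and n: "n \<in> carrier N"
  shows "inv\<^bsub>N\<^esub> (\<xi> a) \<otimes>\<^bsub>N\<^esub> n = n \<otimes>\<^bsub>N\<^esub> inv\<^bsub>N\<^esub> (\<xi> a)"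
proof -
  have "\<xi> (inv\<^bsub>H\<^esub> a) \<in> center N"
    using \<xi>_central subgroup.m_inv_closed[OF C a] by blast
  then show ?thesis
    using n by (simp add: \<xi>_inv a center_def)
qed

text \<open>Inversion reverses products, and centrality restores the order. This makes
  \<open>a\<close> \<mapsto> (a, inv (\<xi> a)) a homomorphism from \<open>C\<close> to
  \<open>Z\<close>.\<close>

lemma inv_\<xi>_mult:
  "\<lbrakk>a \<in> C; b \<in> C\<rbrakk> \<Longrightarrow> inv\<^bsub>N\<^esub> (\<xi> (a \<otimes>\<^bsub>H\<^esub> b)) = inv\<^bsub>N\<^esub> (\<xi> a) \<otimes>\<^bsub>N\<^esub> inv\<^bsub>N\<^esub> (\<xi> b)"
  by (simp add: \<xi>_mult N.inv_mult_group inv_\<xi>_central[of b "inv\<^bsub>N\<^esub> (\<xi> a)"])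

lemma subgroup_Z: "subgroup Z (H \<times>\<times> N)"
proof (rule HN.subgroupI)
  show "Z \<noteq> {}"
    using subgroup.one_closed[OF C] by (auto simp: antidiagonal_def)
  fix z w assume "z \<in> Z" "w \<in> Z"
  then show "z \<otimes>\<^bsub>H \<times>\<times> N\<^esub> w \<in> Z"
    using subgroup.m_closed[OF C] by (auto simp: antidiagonal_def inv_\<xi>_mult)
next
  fix z assume "z \<in> Z"
  then show "inv\<^bsub>H \<times>\<times> N\<^esub> z \<in> Z"
    using subgroup.m_inv_closed[OF C] H.is_group N.is_group by (auto simp: antidiagonal_def \<xi>_inv)
qed (auto simp: antidiagonal_def)

lemma Z_central: "Z \<subseteq> center (H \<times>\<times> N)"
  using C_central by (auto simp: antidiagonal_def center_def inv_\<xi>_central)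

text \<open>Characters of \<open>Z\<close> and of \<open>C\<close> are exchanged by composing with
  \<open>fst\<close> and with its inverse \<open>?\<iota>\<close>. Projection carries commutators
  and derived elements of the product to those of \<open>H\<close>; \<open>K\<close> and
  \<open>D\<close> provide the same for \<open>?\<iota>\<close> in the other direction.\<close>

lemma commutator_detecting_iff:
  assumes "comm_group M"
    and K: "\<And>a. a \<in> C \<Longrightarrow> a \<in> commutators H \<Longrightarrow> \<xi> a \<in> commutators N"
    and D: "\<And>a. a \<in> C \<Longrightarrow> a \<in> derived H (carrier H) \<Longrightarrow> \<xi> a \<in> derived N (carrier N)"
  shows "commutator_detecting (H \<times>\<times> N) Z M \<longleftrightarrow> commutator_detecting H C M"
proof
  interpret fst: group_hom "H \<times>\<times> N" H fst
    by unfold_locales (auto intro: homI)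
  let ?\<iota> = "\<lambda>a. (a, inv\<^bsub>N\<^esub> (\<xi> a))"
  {
    assume det: "commutator_detecting (H \<times>\<times> N) Z M"
    show "commutator_detecting H C M"
      unfolding commutator_detecting_def
    proof (intro ballI impI)
      fix \<chi> a assume \<chi>: "\<chi> \<in> hom (H\<lparr>carrier := C\<rparr>) M" and a: "a \<in> C \<inter> derived H (carrier H)"
        and triv: "\<forall>c\<in>C \<inter> commutators H. \<chi> c = \<one>\<^bsub>M\<^esub>"
      have "\<chi> \<circ> fst \<in> hom ((H \<times>\<times> N)\<lparr>carrier := Z\<rparr>) M"
        using \<chi> by (auto simp: hom_def antidiagonal_def)
      moreover have "\<forall>z\<in>Z \<inter> commutators (H \<times>\<times> N). (\<chi> \<circ> fst) z = \<one>\<^bsub>M\<^esub>"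
        using triv fst.hom_commutators by (fastforce simp: antidiagonal_def)
      ultimately have "\<forall>z\<in>Z \<inter> derived (H \<times>\<times> N) (carrier (H \<times>\<times> N)). (\<chi> \<circ> fst) z = \<one>\<^bsub>M\<^esub>"
        using det unfolding commutator_detecting_def by blast
      moreover have "?\<iota> a \<in> Z"
        using a by (auto simp: antidiagonal_def)
      moreover have "inv\<^bsub>N\<^esub> (\<xi> a) \<in> derived N (carrier N)"
        using a D subgroup.m_inv_closed[OF N.derived_is_subgroup[OF order.refl]] by simp
      then have "?\<iota> a \<in> derived (H \<times>\<times> N) (carrier (H \<times>\<times> N))"
        using a derived_DirProd[OF H.is_group N.is_group] by blast
      ultimately have "(\<chi> \<circ> fst) (?\<iota> a) = \<one>\<^bsub>M\<^esub>"
        by blast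
      then show "\<chi> a = \<one>\<^bsub>M\<^esub>"
        by simp
    qed
  next
    assume det: "commutator_detecting H C M"
    show "commutator_detecting (H \<times>\<times> N) Z M"
      unfolding commutator_detecting_def
    proof (intro ballI impI)
      fix \<chi> z assume \<chi>: "\<chi> \<in> hom ((H \<times>\<times> N)\<lparr>carrier := Z\<rparr>) M"
        and z: "z \<in> Z \<inter> derived (H \<times>\<times> N) (carrier (H \<times>\<times> N))"
        and triv: "\<forall>c\<in>Z \<inter> commutators (H \<times>\<times> N). \<chi> c = \<one>\<^bsub>M\<^esub>"
      have \<iota>: "?\<iota> a \<in> Z" if "a \<in> C" for a
        using that by (auto simp: antidiagonal_def)
      have "\<chi> \<circ> ?\<iota> \<in> hom (H\<lparr>carrier := C\<rparr>) M"
      proof (rule homI)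
        fix a b assume "a \<in> carrier (H\<lparr>carrier := C\<rparr>)" "b \<in> carrier (H\<lparr>carrier := C\<rparr>)"
        then have ab: "a \<in> C" "b \<in> C" by auto
        then have "?\<iota> (a \<otimes>\<^bsub>H\<^esub> b) = ?\<iota> a \<otimes>\<^bsub>H \<times>\<times> N\<^esub> ?\<iota> b"
          by (simp add: inv_\<xi>_mult)
        then show "(\<chi> \<circ> ?\<iota>) (a \<otimes>\<^bsub>H\<lparr>carrier := C\<rparr>\<^esub> b) = (\<chi> \<circ> ?\<iota>) a \<otimes>\<^bsub>M\<^esub> (\<chi> \<circ> ?\<iota>) b"
          using hom_mult[OF \<chi>, of "?\<iota> a" "?\<iota> b"] \<iota> ab by simp
      next
        fix a assume "a \<in> carrier (H\<lparr>carrier := C\<rparr>)"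
        then show "(\<chi> \<circ> ?\<iota>) a \<in> carrier M"
          using hom_in_carrier[OF \<chi>, of "?\<iota> a"] \<iota> by simp
      qed
      moreover have "\<forall>a\<in>C \<inter> commutators H. (\<chi> \<circ> ?\<iota>) a = \<one>\<^bsub>M\<^esub>"
        using triv \<iota> K N.inv_commutators commutators_DirProd[OF H.is_group N.is_group] by simp
      ultimately have "\<forall>a\<in>C \<inter> derived H (carrier H). (\<chi> \<circ> ?\<iota>) a = \<one>\<^bsub>M\<^esub>"
        using det unfolding commutator_detecting_def by blast
      moreover obtain a where "a \<in> C" "z = ?\<iota> a"
        using z by (auto simp: antidiagonal_def)
      moreover have "a \<in> derived H (carrier H)"
        using z fst.hom_derived[of z] \<open>z = ?\<iota> a\<close> by simp
      ultimately show "\<chi> z = \<one>\<^bsub>M\<^esub>"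
        by simp
    qed
  }
qed

end

theorem theorem4p1:
  fixes H :: "('a, 'm) monoid_scheme" and N :: "('b, 'n) monoid_scheme"
    and H\<^sub>1 :: "'a set" and N\<^sub>1 :: "'b set" and \<xi> :: "'a \<Rightarrow> 'b"
  assumes "group H" and "finite (carrier H)"
    and "group N" and "finite (carrier N)"
    and "subgroup H\<^sub>1 H" and "H\<^sub>1 \<subseteq> center H"
    and "subgroup N\<^sub>1 N" and "N\<^sub>1 \<subseteq> center N"
    and "\<xi> \<in> iso (H\<lparr>carrier := H\<^sub>1\<rparr>) (N\<lparr>carrier := N\<^sub>1\<rparr>)"
    and "trivial_bogomolov_multiplier H" and "trivial_bogomolov_multiplier N"
    and "\<xi> ` (H\<^sub>1 \<inter> derived H (carrier H)) \<subseteq> N\<^sub>1 \<inter> commutators N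
      \<or> (\<exists>\<eta>\<in>hom H N. \<forall>a\<in>H\<^sub>1. \<xi> a = \<eta> a)"
  shows "trivial_bogomolov_multiplier (central_product H N H\<^sub>1 \<xi>)
    \<longleftrightarrow> trivial_bogomolov_multiplier (H Mod H\<^sub>1)"
proof -
  note H = assms(1) and N = assms(3) and C = assms(5) and C_central = assms(6)
  interpret H: group H by (rule H)
  interpret N: group N by (rule N)
  interpret M: divisible_group rat_mod_int by (rule divisible_group_rat_mod_int)
  have \<xi>: "\<xi> \<in> hom (H\<lparr>carrier := H\<^sub>1\<rparr>) N" and \<xi>_N\<^sub>1: "\<xi> ` H\<^sub>1 \<subseteq> N\<^sub>1"
    using assms(9) subgroup.subset[OF assms(7)] by (auto simp: iso_def hom_def)
  interpret HN: central_amalgamation H N H\<^sub>1 \<xi>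
    using C C_central \<xi> \<xi>_N\<^sub>1 assms(8) H N
    by (intro central_amalgamation.intro central_amalgamation_axioms.intro) auto
  \<comment> \<open>Under the first condition \<open>a\<close> is in particular a derived element,
    so the inclusion applies; under the second, a homomorphism on all of \<open>H\<close> preserves
    commutators.\<close>
  have K: "\<xi> a \<in> commutators N" if a: "a \<in> H\<^sub>1" "a \<in> commutators H" for a
    using assms(12)
  proof
    assume "\<xi> ` (H\<^sub>1 \<inter> derived H (carrier H)) \<subseteq> N\<^sub>1 \<inter> commutators N"
    then show ?thesis
      using a H.commutators_subset_derived by blast
  next
    assume "\<exists>\<eta>\<in>hom H N. \<forall>a\<in>H\<^sub>1. \<xi> a = \<eta> a"
    then obtain \<eta> where \<eta>: "\<eta> \<in> hom H N" and eq: "\<xi> a = \<eta> a"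
      using a by blast
    interpret \<eta>: group_hom H N \<eta>
      using \<eta> by unfold_locales
    show ?thesis
      unfolding eq using a(2) by (rule \<eta>.hom_commutators)
  qed
  \<comment> \<open>The first condition makes \<xi>(a) a single commutator although \<open>a\<close>
    may be only a product of commutators.\<close>
  have D: "\<xi> a \<in> derived N (carrier N)" if a: "a \<in> H\<^sub>1" "a \<in> derived H (carrier H)" for a
    using assms(12)
  proof
    assume "\<xi> ` (H\<^sub>1 \<inter> derived H (carrier H)) \<subseteq> N\<^sub>1 \<inter> commutators N"
    then show ?thesis
      using a N.commutators_subset_derived by blast
  next
    assume "\<exists>\<eta>\<in>hom H N. \<forall>a\<in>H\<^sub>1. \<xi> a = \<eta> a"
    then obtain \<eta> where \<eta>: "\<eta> \<in> hom H N" and eq: "\<xi> a = \<eta> a"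
      using a by blast
    interpret \<eta>: group_hom H N \<eta>
      using \<eta> by unfold_locales
    show ?thesis
      unfolding eq using a(2) by (rule \<eta>.hom_derived)
  qed
  have split: "commuting_symmetric_split H rat_mod_int" "commuting_symmetric_split N rat_mod_int"
    using assms(2,4,10,11) by (simp_all add: H N trivial_bogomolov_multiplier_iff)
  have fin: "finite (carrier (H \<times>\<times> N))"
    using assms(2,4) by simp
  have "trivial_bogomolov_multiplier ((H \<times>\<times> N) Mod HN.Z) \<longleftrightarrow>
      commutator_detecting (H \<times>\<times> N) HN.Z rat_mod_int"
    using trivial_bogomolov_multiplier_quotient_iff[OF HN.HN.is_group fin HN.subgroup_Z HN.Z_central]
      M.commuting_symmetric_split_DirProd[OF H N split] by blast
  also have "\<dots> \<longleftrightarrow> commutator_detecting H H\<^sub>1 rat_mod_int"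
    by (rule HN.commutator_detecting_iff[OF M.comm_group_axioms K D])
  also have "\<dots> \<longleftrightarrow> trivial_bogomolov_multiplier (H Mod H\<^sub>1)"
    using trivial_bogomolov_multiplier_quotient_iff[OF H assms(2) C C_central split(1)] by blast
  finally show ?thesis
    by (simp add: central_product_def antidiagonal_def)
qed

end
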